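(* Let $k$ be a commutative ring with $\mathbb{Q}\subseteq k$ and let $(A,\mu_0)$ be a coisotropic $k$-algebra with coisotropic Hochschild DGLA $C^\bullet(A)$. Then the set of equivalence classes of formal associative deformations of $A$ coincides with $\mathrm{Def}(C^\bullet(A))$; precisely, the assignment $M\mapsto \mu_0+M$ induces a bijection from $\mathrm{Def}(C^\bullet(A))_N$ onto the set of equivalence classes of formal associative deformations of $(A,\mu_0)$.
   Context: A coisotropic $k$-module $E$ is a triple $(E_{\mathrm{tot}},E_N,E_0)$ of $k$-modules with $E_0\subseteq E_N$ a submodule and a $k$-linear map $\iota_E\colon E_N\to E_{\mathrm{tot}}$. A morphism $E\to F$ is a pair $(\Phi_{\mathrm{tot}},\Phi_N)$ of linear maps $E_{\mathrm{tot}}\to F_{\mathrm{tot}}$, $E_N\to F_N$ with $\Phi_{\mathrm{tot}}\iota_E=\iota_F\Phi_N$ and $\Phi_N(E_0)\subseteq F_0$. The tensor product is $E\otimes F=(E_{\mathrm{tot}}\otimes F_{\mathrm{tot}},\,E_N\otimes F_N,\,E_N\otimes F_0+E_0\otimes F_N)$ with $\iota=\iota_E\otimes\iota_F$ (the $0$-component being the submodule of $E_N\otimes F_N$ generated by the indicated elementary tensors). A coisotropic $k$-algebra $(A,\mu_0)$ consists of unital associative $k$-algebras $A_{\mathrm{tot}},A_N$, a unital algebra homomorphism $\iota_A\colon A_N\to A_{\mathrm{tot}}$ and a two-sided ideal $A_0\subseteq A_N$; $\mu_0=((\mu_0)_{\mathrm{tot}},(\mu_0)_N)\colon A\otimes A\to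 A$ denotes the multiplication. $A[[\lambda]]=(A_{\mathrm{tot}}[[\lambda]],A_N[[\lambda]],A_0[[\lambda]])$ with $\lambda$-linear extension of $\iota_A$. Formal associative deformation of $(A,\mu_0)$: an associative $k[[\lambda]]$-bilinear multiplication $\mu=(\mu_{\mathrm{tot}},\mu_N)$ on $A[[\lambda]]$ making $A[[\lambda]]$ (with the undeformed $\iota_A$ and with $A_0[[\lambda]]$ as ideal) a coisotropic $k[[\lambda]]$-algebra, of the form $\mu=\mu_0+\sum_{r\ge1}\lambda^r\mu_r$ with morphisms of coisotropic modules $\mu_r\colon A\otimes A\to A$ (the units may depend on $\lambda$). Two deformations $\mu,\mu'$ are equivalent if there is an automorphism $T=(T_{\mathrm{tot}},T_N)$ of the coisotropic $k[[\lambda]]$-module $A[[\lambda]]$, $T=\mathrm{id}+\lambda(\cdots)$, with $T\circ\mu=\mu'\circ(T\otimes T)$ in both components. Hochschild DGLA: $C^n(A)_{\mathrm{tot}}=\mathrm{Hom}_k(A_{\mathrm{tot}}^{\otimes n},A_{\mathrm{tot}})$; $C^n(A)_N$ is the set of morphisms of coisotropic modules $A^{\otimes n}\to A$, i.e. pairs $(f_{\mathrm{tot}},f_N)$ compatible with $\iota$ such that $f_N$ takes values in $A_0$ whenever at least one argument is in $A_0$; $C^n(A)_0$ consists of those pairs with $f_N(A_N^{\otimes n})\subseteq A_0$; $\iota(f_{\mathrm{tot}},f_N)=f_{\mathrm{tot}}$. The bracket is the Gerstenhaber bracket, applied componentwise: for $f\in C^m,g\in C^n$, $[f,g]=f\circ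 g-(-1)^{(m-1)(n-1)}g\circ f$, $(f\circ g)(a_1,\dots,a_{m+n-1})=\sum_{i=0}^{m-1}(-1)^{i(n-1)}f(a_1,\dots,a_i,g(a_{i+1},\dots,a_{i+n}),a_{i+n+1},\dots)$. As a coisotropic DGLA, $C^n(A)$ sits in degree $n-1$ (so degree-$1$ elements are $2$-cochains and degree-$0$ elements are $1$-cochains) and the differential is $d=[\mu_0,\cdot]$ (with $(\mu_0)_{\mathrm{tot}}$ in the tot-component). For a coisotropic DGLA $\mathfrak g=(\mathfrak g_{\mathrm{tot}},\mathfrak g_N,\mathfrak g_0)$, $\mathrm{Def}(\mathfrak g)_N$ is the set of $\xi\in\lambda\mathfrak g_N^1[[\lambda]]$ with $d\xi+\frac12[\xi,\xi]=0$ modulo the action of the group $\lambda\mathfrak g_N^0[[\lambda]]$ (with Baker-Campbell-Hausdorff multiplication) given by $\lambda g\triangleright\xi=e^{\lambda\,\mathrm{ad}(g)}(\xi)-\lambda\sum_{j\ge0}\frac{(\lambda\,\mathrm{ad}(g))^j}{(1+j)!}(dg)$. *)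

theory Defs
  imports
    "HOL-Computational_Algebra.Formal_Power_Series"
    "HOL-Library.Function_Algebras"
    "HOL-Library.Product_Plus"
begin

section \<open>Coisotropic modules and algebras\<close>

text \<open>
  A commutative ring \<open>k\<close> containing the rationals is given with its (unique) embedding of
  \<open>rat\<close>, which supplies the scalars \<open>1/2\<close> and \<open>1/j!\<close> below.
\<close>

definition rat_embedding :: "(rat \<Rightarrow> 'k::comm_ring_1) \<Rightarrow> bool" where
  "rat_embedding q \<longleftrightarrow>
     q 1 = 1 \<and> (\<forall>x y. q (x + y) = q x + q y) \<and> (\<forall>x y. q (x * y) = q x * q y) \<and> inj q"

record ('k, 'a, 'n) coiso_module =
  scaleT :: "'k \<Rightarrow> 'a \<Rightarrow> 'a"
  scaleN :: "'k \<Rightarrow> 'n \<Rightarrow> 'n"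
  incl :: "'n \<Rightarrow> 'a"
  sub0 :: "'n set"

definition coisotropic_module ::
    "('k::comm_ring_1, 'a::ab_group_add, 'n::ab_group_add, 'z) coiso_module_scheme \<Rightarrow> bool" where
  "coisotropic_module E \<longleftrightarrow>
     module (scaleT E) \<and> module (scaleN E) \<and>
     module_hom (scaleN E) (scaleT E) (incl E) \<and> module.subspace (scaleN E) (sub0 E)"

definition coisotropic_morphism ::
    "('k::comm_ring_1, 'a::ab_group_add, 'n::ab_group_add, 'y) coiso_module_scheme \<Rightarrow>
     ('k, 'b::ab_group_add, 'm::ab_group_add, 'z) coiso_module_scheme \<Rightarrow>
     ('a \<Rightarrow> 'b) \<times> ('n \<Rightarrow> 'm) \<Rightarrow> bool" where
  "coisotropic_morphism E F \<Phi> \<longleftrightarrow>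
     module_hom (scaleT E) (scaleT F) (fst \<Phi>) \<and>
     module_hom (scaleN E) (scaleN F) (snd \<Phi>) \<and>
     (\<forall>x. fst \<Phi> (incl E x) = incl F (snd \<Phi> x)) \<and>
     snd \<Phi> ` sub0 E \<subseteq> sub0 F"

text \<open>The multiplication is kept as an explicit operation (rather than coming from a type class)
  because a deformation replaces it. No assumption \<open>0 \<noteq> 1\<close> is made on algebras.\<close>

record ('k, 'a, 'n) coiso_algebra = "('k, 'a, 'n) coiso_module" +
  mulT :: "'a \<Rightarrow> 'a \<Rightarrow> 'a"
  mulN :: "'n \<Rightarrow> 'n \<Rightarrow> 'n"

definition unital_algebra ::
    "('k::comm_ring_1 \<Rightarrow> 'a::ab_group_add \<Rightarrow> 'a) \<Rightarrow> ('a \<Rightarrow> 'a \<Rightarrow> 'a) \<Rightarrow> 'a \<Rightarrow> bool" where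
  "unital_algebra s m e \<longleftrightarrow>
     module s \<and>
     (\<forall>x. module_hom s s (m x)) \<and> (\<forall>y. module_hom s s (\<lambda>x. m x y)) \<and>
     (\<forall>x y z. m (m x y) z = m x (m y z)) \<and>
     (\<forall>x. m e x = x \<and> m x e = x)"

definition coisotropic_algebra ::
    "('k::comm_ring_1, 'a::ab_group_add, 'n::ab_group_add) coiso_algebra \<Rightarrow> bool" where
  "coisotropic_algebra A \<longleftrightarrow>
     coisotropic_module A \<and>
     (\<exists>eT eN. unital_algebra (scaleT A) (mulT A) eT \<and> unital_algebra (scaleN A) (mulN A) eN \<and>
        incl A eN = eT) \<and>
     (\<forall>x y. incl A (mulN A x y) = mulT A (incl A x) (incl A y)) \<and>
     (\<forall>x. \<forall>z \<in> sub0 A. mulN A x z \<in> sub0 A \<and> mulN A z x \<in> sub0 A)"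

section \<open>Formal power series with coefficients in a module\<close>

text \<open>\<open>V[[\<lambda>]]\<close> is the type \<open>'v fps\<close>; \<open>fps_map\<close> and \<open>fps_conv\<close> are the
  \<open>\<lambda>\<close>-linear and \<open>\<lambda>\<close>-bilinear extensions of an additive and a biadditive map.\<close>

definition fps_map :: "('u \<Rightarrow> 'v) \<Rightarrow> 'u fps \<Rightarrow> 'v fps" where
  "fps_map f x = Abs_fps (\<lambda>n. f (fps_nth x n))"

definition fps_conv ::
    "('u \<Rightarrow> 'v \<Rightarrow> 'w::comm_monoid_add) \<Rightarrow> 'u fps \<Rightarrow> 'v fps \<Rightarrow> 'w fps" where
  "fps_conv b x y = Abs_fps (\<lambda>n. \<Sum>i=0..n. b (fps_nth x i) (fps_nth y (n - i)))"

definition series_module ::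
    "('k::comm_ring_1, 'a::ab_group_add, 'n::ab_group_add, 'z) coiso_module_scheme \<Rightarrow>
     ('k fps, 'a fps, 'n fps) coiso_module" where
  "series_module E =
     \<lparr> scaleT = fps_conv (scaleT E),
       scaleN = fps_conv (scaleN E),
       incl = fps_map (incl E),
       sub0 = {x. \<forall>n. fps_nth x n \<in> sub0 E} \<rparr>"

definition series_algebra ::
    "('k::comm_ring_1, 'a::ab_group_add, 'n::ab_group_add, 'z) coiso_module_scheme \<Rightarrow>
     ('a fps \<Rightarrow> 'a fps \<Rightarrow> 'a fps) \<times> ('n fps \<Rightarrow> 'n fps \<Rightarrow> 'n fps) \<Rightarrow>
     ('k fps, 'a fps, 'n fps) coiso_algebra" where
  "series_algebra E \<mu> =
     coiso_module.extend (series_module E) (coiso_algebra.fields (fst \<mu>) (snd \<mu>))"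

section \<open>Coisotropic differential graded Lie algebras and their deformation functor\<close>

text \<open>
  All homogeneous components live in one type \<open>'v\<close>, the component of degree \<open>p\<close> being the
  subset \<open>homog p\<close>; bracket and differential take the degrees of their arguments.
\<close>

record ('k, 'v) dgla =
  homog :: "int \<Rightarrow> 'v set"
  scal :: "'k \<Rightarrow> 'v \<Rightarrow> 'v"
  brak :: "int \<Rightarrow> int \<Rightarrow> 'v \<Rightarrow> 'v \<Rightarrow> 'v"
  diff :: "int \<Rightarrow> 'v \<Rightarrow> 'v"

record ('k, 'v, 'w) coiso_dgla =
  dglaT :: "('k, 'v) dgla"
  dglaN :: "('k, 'w) dgla"
  dgla_incl :: "'w \<Rightarrow> 'v"
  homog0 :: "int \<Rightarrow> 'w set"

text \<open>\<open>\<lambda> g\<^sup>p[[\<lambda>]]\<close>\<close>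

definition lambda_comp :: "('k, 'v::ab_group_add) dgla \<Rightarrow> int \<Rightarrow> 'v fps set" where
  "lambda_comp g p = {x. fps_nth x 0 = 0 \<and> (\<forall>n. fps_nth x n \<in> homog g p)}"

definition maurer_cartan ::
    "(rat \<Rightarrow> 'k::comm_ring_1) \<Rightarrow> ('k, 'v::ab_group_add) dgla \<Rightarrow> 'v fps set" where
  "maurer_cartan q g =
     {\<xi> \<in> lambda_comp g 1.
        fps_map (diff g 1) \<xi> + fps_map (scal g (q (1/2))) (fps_conv (brak g 1 1) \<xi> \<xi>) = 0}"

text \<open>
  The element of the gauge group written \<open>\<lambda>g\<close> is \<open>\<gamma>\<close> here, a series without constant term;
  by \<open>\<lambda>\<close>-linearity \<open>\<lambda> (\<lambda> ad g)\<^sup>j (dg) = (ad \<gamma>)\<^sup>j (d\<gamma>)\<close>.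
  As \<open>(ad \<gamma>)\<^sup>j\<close> raises the order in \<open>\<lambda>\<close> by at least \<open>j\<close>, the terms with \<open>j > n\<close> do not
  contribute to the coefficient of \<open>\<lambda>\<^sup>n\<close>, so truncating there is the \<open>\<lambda>\<close>-adic sum.
\<close>

definition gauge_act ::
    "(rat \<Rightarrow> 'k::comm_ring_1) \<Rightarrow> ('k, 'v::ab_group_add) dgla \<Rightarrow> 'v fps \<Rightarrow> 'v fps \<Rightarrow> 'v fps" where
  "gauge_act q g \<gamma> \<xi> =
     (let ad = fps_conv (brak g 0 1) \<gamma> in
      Abs_fps (\<lambda>n. \<Sum>j=0..n. scal g (q (1 / fact j)) (fps_nth ((ad ^^ j) \<xi>) n)) -
      Abs_fps (\<lambda>n. \<Sum>j=0..n.
        scal g (q (1 / fact (1 + j))) (fps_nth ((ad ^^ j) (fps_map (diff g 0) \<gamma>)) n)))"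

definition gauge_rel ::
    "(rat \<Rightarrow> 'k::comm_ring_1) \<Rightarrow> ('k, 'v::ab_group_add) dgla \<Rightarrow> ('v fps \<times> 'v fps) set" where
  "gauge_rel q g =
     {(\<xi>, \<xi>'). \<xi> \<in> maurer_cartan q g \<and> \<xi>' \<in> maurer_cartan q g \<and>
        (\<exists>\<gamma> \<in> lambda_comp g 0. \<xi>' = gauge_act q g \<gamma> \<xi>)}"

definition Def_N ::
    "(rat \<Rightarrow> 'k::comm_ring_1) \<Rightarrow> ('k, 'v, 'w::ab_group_add) coiso_dgla \<Rightarrow> 'w fps set set" where
  "Def_N q g = maurer_cartan q (dglaN g) // gauge_rel q (dglaN g)"

section \<open>The coisotropic Hochschild DGLA\<close>

text \<open>
  A \<open>k\<close>-linear map on an \<open>n\<close>-fold tensor power is encoded as the corresponding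
  \<open>k\<close>-multilinear map, taken as a function on lists which is \<open>0\<close> on lists of length
  different from \<open>n\<close>.
\<close>

definition multilinear :: "('k::comm_ring_1 \<Rightarrow> 'a::ab_group_add \<Rightarrow> 'a) \<Rightarrow> nat \<Rightarrow> ('a list \<Rightarrow> 'a) \<Rightarrow> bool"
  where
  "multilinear s n f \<longleftrightarrow>
     (\<forall>xs. length xs \<noteq> n \<longrightarrow> f xs = 0) \<and>
     (\<forall>xs i. length xs = n \<and> i < n \<longrightarrow> module_hom s s (\<lambda>x. f (xs[i := x])))"

definition cochainsT ::
    "('k::comm_ring_1, 'a::ab_group_add, 'n::ab_group_add, 'z) coiso_module_scheme \<Rightarrow> nat \<Rightarrow>
     ('a list \<Rightarrow> 'a) set" where
  "cochainsT A n = {f. multilinear (scaleT A) n f}"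

definition cochainsN ::
    "('k::comm_ring_1, 'a::ab_group_add, 'n::ab_group_add, 'z) coiso_module_scheme \<Rightarrow> nat \<Rightarrow>
     (('a list \<Rightarrow> 'a) \<times> ('n list \<Rightarrow> 'n)) set" where
  "cochainsN A n =
     {(fT, fN). multilinear (scaleT A) n fT \<and> multilinear (scaleN A) n fN \<and>
        (\<forall>xs. length xs = n \<longrightarrow> incl A (fN xs) = fT (map (incl A) xs)) \<and>
        (\<forall>xs. length xs = n \<and> (\<exists>x \<in> set xs. x \<in> sub0 A) \<longrightarrow> fN xs \<in> sub0 A)}"

definition cochains0 ::
    "('k::comm_ring_1, 'a::ab_group_add, 'n::ab_group_add, 'z) coiso_module_scheme \<Rightarrow> nat \<Rightarrow>
     (('a list \<Rightarrow> 'a) \<times> ('n list \<Rightarrow> 'n)) set" where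
  "cochains0 A n =
     {(fT, fN) \<in> cochainsN A n. \<forall>xs. length xs = n \<longrightarrow> fN xs \<in> sub0 A}"

text \<open>\<open>signed p x = (-1)\<^sup>p x\<close>. The exponent is an integer because \<open>n - 1\<close> below is
  negative for \<open>n = 0\<close>.\<close>

definition signed :: "int \<Rightarrow> 'a::ab_group_add \<Rightarrow> 'a" where
  "signed p x = (if even p then x else - x)"

definition gerst_comp :: "nat \<Rightarrow> nat \<Rightarrow> ('a::ab_group_add list \<Rightarrow> 'a) \<Rightarrow> ('a list \<Rightarrow> 'a) \<Rightarrow> 'a list \<Rightarrow> 'a"
  where
  "gerst_comp m n f g xs =
     (if length xs + 1 = m + n
      then \<Sum>i<m. signed (int i * (int n - 1))
             (f (take i xs @ g (take n (drop i xs)) # drop (i + n) xs))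
      else 0)"

definition gerst_bracket ::
    "nat \<Rightarrow> nat \<Rightarrow> ('a::ab_group_add list \<Rightarrow> 'a) \<Rightarrow> ('a list \<Rightarrow> 'a) \<Rightarrow> 'a list \<Rightarrow> 'a" where
  "gerst_bracket m n f g =
     gerst_comp m n f g - signed ((int m - 1) * (int n - 1)) (gerst_comp n m g f)"

definition gerst_bracketN ::
    "nat \<Rightarrow> nat \<Rightarrow> ('a::ab_group_add list \<Rightarrow> 'a) \<times> ('n::ab_group_add list \<Rightarrow> 'n) \<Rightarrow>
     ('a list \<Rightarrow> 'a) \<times> ('n list \<Rightarrow> 'n) \<Rightarrow> ('a list \<Rightarrow> 'a) \<times> ('n list \<Rightarrow> 'n)" where
  "gerst_bracketN m n f g =
     (gerst_bracket m n (fst f) (fst g), gerst_bracket m n (snd f) (snd g))"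

definition cochain2 :: "('a::ab_group_add \<Rightarrow> 'a \<Rightarrow> 'a) \<Rightarrow> 'a list \<Rightarrow> 'a" where
  "cochain2 m xs = (if length xs = 2 then m (xs ! 0) (xs ! 1) else 0)"

definition mu0 ::
    "('k::comm_ring_1, 'a::ab_group_add, 'n::ab_group_add) coiso_algebra \<Rightarrow>
     ('a list \<Rightarrow> 'a) \<times> ('n list \<Rightarrow> 'n)" where
  "mu0 A = (cochain2 (mulT A), cochain2 (mulN A))"

text \<open>Arity of the cochains of DGLA degree \<open>p \<ge> -1\<close>; the degrees below \<open>-1\<close> are zero.\<close>

definition arity :: "int \<Rightarrow> nat" where
  "arity p = nat (p + 1)"

definition graded :: "(nat \<Rightarrow> 'v::zero set) \<Rightarrow> int \<Rightarrow> 'v set" where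
  "graded C p = (if p \<ge> -1 then C (arity p) else {0})"

definition hochschildT ::
    "('k::comm_ring_1, 'a::ab_group_add, 'n::ab_group_add) coiso_algebra \<Rightarrow>
     ('k, 'a list \<Rightarrow> 'a) dgla" where
  "hochschildT A =
     \<lparr> homog = graded (cochainsT A),
       scal = (\<lambda>c f xs. scaleT A c (f xs)),
       brak = (\<lambda>p q. gerst_bracket (arity p) (arity q)),
       diff = (\<lambda>p. gerst_bracket 2 (arity p) (fst (mu0 A))) \<rparr>"

definition hochschildN ::
    "('k::comm_ring_1, 'a::ab_group_add, 'n::ab_group_add) coiso_algebra \<Rightarrow>
     ('k, ('a list \<Rightarrow> 'a) \<times> ('n list \<Rightarrow> 'n)) dgla" where
  "hochschildN A =
     \<lparr> homog = graded (cochainsN A),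
       scal = (\<lambda>c (fT, fN). (\<lambda>xs. scaleT A c (fT xs), \<lambda>xs. scaleN A c (fN xs))),
       brak = (\<lambda>p q. gerst_bracketN (arity p) (arity q)),
       diff = (\<lambda>p. gerst_bracketN 2 (arity p) (mu0 A)) \<rparr>"

definition hochschild ::
    "('k::comm_ring_1, 'a::ab_group_add, 'n::ab_group_add) coiso_algebra \<Rightarrow>
     ('k, 'a list \<Rightarrow> 'a, ('a list \<Rightarrow> 'a) \<times> ('n list \<Rightarrow> 'n)) coiso_dgla" where
  "hochschild A =
     \<lparr> dglaT = hochschildT A,
       dglaN = hochschildN A,
       dgla_incl = fst,
       homog0 = graded (cochains0 A) \<rparr>"

section \<open>Formal associative deformations\<close>

text \<open>The \<open>\<lambda>\<close>-bilinear product on \<open>A[[\<lambda>]]\<close> given by a series \<open>F\<close> of 2-cochains.\<close>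

definition bilin_ext :: "('a::ab_group_add list \<Rightarrow> 'a) fps \<Rightarrow> 'a fps \<Rightarrow> 'a fps \<Rightarrow> 'a fps" where
  "bilin_ext F x y = Abs_fps (\<lambda>n. \<Sum>r=0..n. \<Sum>i=0..n - r.
     fps_nth F r [fps_nth x i, fps_nth y (n - r - i)])"

definition product_of ::
    "(('a::ab_group_add list \<Rightarrow> 'a) \<times> ('n::ab_group_add list \<Rightarrow> 'n)) fps \<Rightarrow>
     ('a fps \<Rightarrow> 'a fps \<Rightarrow> 'a fps) \<times> ('n fps \<Rightarrow> 'n fps \<Rightarrow> 'n fps)" where
  "product_of F = (bilin_ext (fps_map fst F), bilin_ext (fps_map snd F))"

definition deformations ::
    "('k::comm_ring_1, 'a::ab_group_add, 'n::ab_group_add) coiso_algebra \<Rightarrow>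
     (('a fps \<Rightarrow> 'a fps \<Rightarrow> 'a fps) \<times> ('n fps \<Rightarrow> 'n fps \<Rightarrow> 'n fps)) set" where
  "deformations A =
     {\<mu>. coisotropic_algebra (series_algebra A \<mu>) \<and>
        (\<exists>F. fps_nth F 0 = mu0 A \<and> (\<forall>r\<ge>1. fps_nth F r \<in> cochainsN A 2) \<and> \<mu> = product_of F)}"

text \<open>Automorphisms of the coisotropic \<open>k[[\<lambda>]]\<close>-module \<open>A[[\<lambda>]]\<close> of the form
  \<open>id + \<lambda>(\<dots>)\<close>, i.e. inducing the identity modulo \<open>\<lambda>\<close>.\<close>

definition formal_automorphism ::
    "('k::comm_ring_1, 'a::ab_group_add, 'n::ab_group_add) coiso_algebra \<Rightarrow>
     ('a fps \<Rightarrow> 'a fps) \<times> ('n fps \<Rightarrow> 'n fps) \<Rightarrow> bool" where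
  "formal_automorphism A T \<longleftrightarrow>
     coisotropic_morphism (series_module A) (series_module A) T \<and>
     (\<exists>S. coisotropic_morphism (series_module A) (series_module A) S \<and>
        fst S \<circ> fst T = id \<and> fst T \<circ> fst S = id \<and>
        snd S \<circ> snd T = id \<and> snd T \<circ> snd S = id) \<and>
     (\<forall>x. fps_nth (fst T x) 0 = fps_nth x 0) \<and>
     (\<forall>x. fps_nth (snd T x) 0 = fps_nth x 0)"

definition deformation_equiv ::
    "('k::comm_ring_1, 'a::ab_group_add, 'n::ab_group_add) coiso_algebra \<Rightarrow>
     ((('a fps \<Rightarrow> 'a fps \<Rightarrow> 'a fps) \<times> ('n fps \<Rightarrow> 'n fps \<Rightarrow> 'n fps)) \<times>
      (('a fps \<Rightarrow> 'a fps \<Rightarrow> 'a fps) \<times> ('n fps \<Rightarrow> 'n fps \<Rightarrow> 'n fps))) set" where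
  "deformation_equiv A =
     {(\<mu>, \<mu>'). \<mu> \<in> deformations A \<and> \<mu>' \<in> deformations A \<and>
        (\<exists>T. formal_automorphism A T \<and>
           (\<forall>x y. fst T (fst \<mu> x y) = fst \<mu>' (fst T x) (fst T y)) \<and>
           (\<forall>x y. snd T (snd \<mu> x y) = snd \<mu>' (snd T x) (snd T y)))}"

end

theory Submission
  imports Defs
begin

text \<open>
  A Maurer--Cartan element \<open>M\<close> is exactly a series for which \<open>\<mu>\<^sub>0 + M\<close> is associative, and an associative
  deformation of a unital product is again unital, so \<open>M \<mapsto> \<mu>\<^sub>0 + M\<close> is a bijection onto the deformations.
  Since \<open>d\<gamma> = -[\<gamma>, \<mu>\<^sub>0]\<close>, the gauge action reads \<open>\<mu>\<^sub>0 + \<gamma> \<triangleright> M = e\<^bsup>ad \<gamma>\<^esup>(\<mu>\<^sub>0 + M)\<close>. Write \<open>ad \<gamma>\<close> on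
  bilinear maps as the postcomposition \<open>L\<close> with \<open>\<gamma>\<close> minus the precompositions \<open>R\<^sub>1\<close>, \<open>R\<^sub>2\<close> in the two arguments.
  These operators commute, so \<open>e\<^sup>L = e\<^bsup>R\<^sub>1\<^esup> e\<^bsup>R\<^sub>2\<^esup> e\<^bsup>ad \<gamma>\<^esup>\<close>, which says that \<open>T = e\<^sup>\<gamma>\<close> satisfies
  \<open>T \<circ> \<mu> = e\<^bsup>ad \<gamma>\<^esup>(\<mu>) \<circ> (T \<otimes> T)\<close>. Every automorphism \<open>T = id + \<lambda>(\<dots>)\<close> is such an exponential, its logarithm
  being a convergent power series in \<open>T - id\<close>. Hence gauge equivalence is equivalence of deformations; in
  particular it is transitive, and the Baker--Campbell--Hausdorff formula is never needed.
\<close>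

section \<open>Power series with coefficients in a module\<close>

text \<open>No topology is set up. A \<lambda>-linear operator on series that produces no constant
  coefficient raises the order by at least one, so each coefficient of a power series in it is a
  finite sum; the truncation in \<open>gauge_act\<close> is of this kind. Such power series have
  coefficients in \<open>rat\<close>, which \<open>q\<close> sends to \<open>k\<close>; identities
  such as the one between exp and log are proved over the rationals and inherited by all operators.
  The factors \<open>1/(1+j)!\<close> in the gauge action are those of the exponential series with
  its term \<open>j = 0\<close> split off and the index shifted. The components tot and N are
  treated by one argument on a single module, applied twice. They meet only through
  \<open>incl\<close> and \<open>sub0\<close>: in the cochain conditions, in the compatibility of
  the units, and in the morphism conditions for exponentials and logarithms. The list encoding of
  cochains is exchanged for curried maps; the price is that values on lists of the wrong length have
  to be checked separately whenever two cochains are identified.\<close>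

lemma rat_embedding_simps:
  assumes "rat_embedding q"
  shows "q 0 = 0" "q 1 = 1" "q (x + y) = q x + q y" "q (x * y) = q x * q y"
    "q (- x) = - q x" "q (x - y) = q x - q y" "q (sum f S) = (\<Sum>i\<in>S. q (f i))"
proof -
  interpret additive q
    using assms by unfold_locales (auto simp: rat_embedding_def)
  show "q 0 = 0" "q 1 = 1" "q (x + y) = q x + q y" "q (x * y) = q x * q y"
    "q (- x) = - q x" "q (x - y) = q x - q y" "q (sum f S) = (\<Sum>i\<in>S. q (f i))"
    using assms by (auto simp: rat_embedding_def zero add minus diff sum)
qed

lemma sum_nat_flip: "(\<Sum>i=0..n. f i (n - i)) = (\<Sum>i=0..n. f (n - i) i)"
  for f :: "nat \<Rightarrow> nat \<Rightarrow> 'a::comm_monoid_add"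
  by (rule sum.reindex_bij_witness[where i="\<lambda>i. n - i" and j="\<lambda>i. n - i"]) auto

lemma sum_triangle_swap:
  "(\<Sum>i=0..n. \<Sum>j=0..n-i. f i j) = (\<Sum>j=0..n. \<Sum>i=0..n-j. f i j)"
  for f :: "nat \<Rightarrow> nat \<Rightarrow> 'a::comm_monoid_add"
proof -
  have "(\<Sum>i=0..n. \<Sum>j=0..n-i. f i j) = (\<Sum>(i,j)\<in>(SIGMA i:{0..n}. {0..n-i}). f i j)"
    by (rule sum.Sigma) auto
  also have "\<dots> = (\<Sum>(j,i)\<in>(SIGMA j:{0..n}. {0..n-j}). f i j)"
    by (rule sum.reindex_bij_witness[where i="\<lambda>(a,b). (b,a)" and j="\<lambda>(a,b). (b,a)"]) auto
  also have "\<dots> = (\<Sum>j=0..n. \<Sum>i=0..n-j. f i j)"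
    by (rule sum.Sigma[symmetric]) auto
  finally show ?thesis .
qed

lemma fps_map_nth [simp]: "fps_nth (fps_map f x) n = f (fps_nth x n)"
  by (simp add: fps_map_def)

lemma fps_conv_nth: "fps_nth (fps_conv b x y) n = (\<Sum>i=0..n. b (fps_nth x i) (fps_nth y (n - i)))"
  by (simp add: fps_conv_def)

lemma fps_conv_flip: "fps_conv b x y = fps_conv (\<lambda>v u. b u v) y x"
  by (rule fps_ext) (simp add: fps_conv_nth sum_nat_flip[of "\<lambda>i j. b (fps_nth x i) (fps_nth y j)"])

lemma fps_conv_map_right: "fps_conv b x (fps_map h y) = fps_conv (\<lambda>u v. b u (h v)) x y"
  by (rule fps_ext) (simp add: fps_conv_nth)

lemma fps_map_conv:
  assumes "additive h" and "\<And>i j. h (b (fps_nth x i) (fps_nth y j)) = c (fps_nth x i) (fps_nth y j)"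
  shows "fps_map h (fps_conv b x y) = fps_conv c x y"
  by (rule fps_ext) (simp add: fps_conv_nth additive.sum[OF assms(1)] assms(2))

text \<open>Additivity and the exchange law are asked only at the coefficients of the given series:
  some pairings below, such as evaluation of functions at a sum, are additive only when those
  coefficients are linear or bilinear.\<close>

lemma fps_conv_assoc:
  assumes "\<And>k. additive (\<lambda>u. b1 u (fps_nth z k))" and "\<And>i. additive (b3 (fps_nth x i))"
    and "\<And>i j k. b1 (b2 (fps_nth x i) (fps_nth y j)) (fps_nth z k) =
        b3 (fps_nth x i) (b4 (fps_nth y j) (fps_nth z k))"
  shows "fps_conv b1 (fps_conv b2 x y) z = fps_conv b3 x (fps_conv b4 y z)"
proof (rule fps_ext)
  fix n
  have "fps_nth (fps_conv b1 (fps_conv b2 x y) z) n =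
      (\<Sum>j=0..n. \<Sum>i=0..j. b1 (b2 (fps_nth x i) (fps_nth y (j - i))) (fps_nth z (n - j)))"
    by (simp add: fps_conv_nth additive.sum[OF assms(1)])
  also have "\<dots> = (\<Sum>j=0..n. \<Sum>i=0..n - j. b1 (b2 (fps_nth x j) (fps_nth y i)) (fps_nth z (n - j - i)))"
    by (rule fps_mult_assoc_lemma)
  also have "\<dots> = fps_nth (fps_conv b3 x (fps_conv b4 y z)) n"
    by (simp add: fps_conv_nth additive.sum[OF assms(2)] assms(3))
  finally show "fps_nth (fps_conv b1 (fps_conv b2 x y) z) n =
      fps_nth (fps_conv b3 x (fps_conv b4 y z)) n" .
qed

text \<open>The hypothesis is that two left actions commute. With scalar multiplication as one of
  them this gives \<lambda>-linearity in \<open>fps_conv_hom\<close>; with two operators on bilinear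
  maps it gives \<open>commute\<close>.\<close>

lemma fps_conv_left_commute:
  assumes "\<And>i. additive (b1 (fps_nth x i))" and "\<And>j. additive (b3 (fps_nth y j))"
    and "\<And>i j k. b1 (fps_nth x i) (b2 (fps_nth y j) (fps_nth z k)) =
        b3 (fps_nth y j) (b4 (fps_nth x i) (fps_nth z k))"
  shows "fps_conv b1 x (fps_conv b2 y z) = fps_conv b3 y (fps_conv b4 x z)"
proof (rule fps_ext)
  fix n
  have "fps_nth (fps_conv b1 x (fps_conv b2 y z)) n =
      (\<Sum>i=0..n. \<Sum>j=0..n-i. b1 (fps_nth x i) (b2 (fps_nth y j) (fps_nth z (n - i - j))))"
    by (simp add: fps_conv_nth additive.sum[OF assms(1)])
  also have "\<dots> = (\<Sum>j=0..n. \<Sum>i=0..n-j. b1 (fps_nth x i) (b2 (fps_nth y j) (fps_nth z (n - i - j))))"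
    by (rule sum_triangle_swap)
  also have "\<dots> = fps_nth (fps_conv b3 y (fps_conv b4 x z)) n"
    by (simp add: fps_conv_nth additive.sum[OF assms(2)] assms(3) add.commute diff_diff_eq)
  finally show "fps_nth (fps_conv b1 x (fps_conv b2 y z)) n =
      fps_nth (fps_conv b3 y (fps_conv b4 x z)) n" .
qed

lemma fps_conv_add_right:
  assumes "\<And>i. additive (b (fps_nth x i))"
  shows "fps_conv b x (y + z) = fps_conv b x y + fps_conv b x z"
  by (rule fps_ext) (simp add: fps_conv_nth additive.add[OF assms] sum.distrib)

lemma fps_conv_add_left:
  assumes "\<And>i. additive (\<lambda>u. b u (fps_nth z i))"
  shows "fps_conv b (x + y) z = fps_conv b x z + fps_conv b y z"
  by (rule fps_ext) (simp add: fps_conv_nth additive.add[OF assms] sum.distrib)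

lemma fps_conv_const_left:
  assumes "\<And>v. b 0 v = 0"
  shows "fps_conv b (fps_const a) x = fps_map (b a) x"
proof (rule fps_ext)
  fix n
  have "(\<Sum>i=0..n. b (fps_nth (fps_const a) i) (fps_nth x (n - i))) =
      (\<Sum>i\<in>{0}. b (fps_nth (fps_const a) i) (fps_nth x (n - i)))"
    by (rule sum.mono_neutral_right) (auto simp: assms)
  then show "fps_nth (fps_conv b (fps_const a) x) n = fps_nth (fps_map (b a) x) n"
    by (simp add: fps_conv_nth)
qed

lemma fps_conv_const_right:
  assumes "\<And>i. b (fps_nth x i) 0 = 0"
  shows "fps_conv b x (fps_const a) = fps_map (\<lambda>u. b u a) x"
proof (rule fps_ext)
  fix n
  have "(\<Sum>i=0..n. b (fps_nth x i) (fps_nth (fps_const a) (n - i))) =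
      (\<Sum>i\<in>{n}. b (fps_nth x i) (fps_nth (fps_const a) (n - i)))"
    by (rule sum.mono_neutral_right) (auto simp: assms)
  then show "fps_nth (fps_conv b x (fps_const a)) n = fps_nth (fps_map (\<lambda>u. b u a) x) n"
    by (simp add: fps_conv_nth)
qed

section \<open>Modules over \<open>k[[\<lambda>]]\<close> and their linear maps\<close>

lemma module_hom_additive: "module_hom s t f \<Longrightarrow> additive f"
  by (simp add: additive_def module_hom.add)

lemma additive_scale: "module s \<Longrightarrow> additive (s c)"
  by (simp add: additive_def module.scale_right_distrib)

lemma additive_scale_left: "module s \<Longrightarrow> additive (\<lambda>c. s c v)"
  by (simp add: additive_def module.scale_left_distrib)

lemma module_series:
  assumes "module s"
  shows "module (fps_conv s)"
proof -
  interpret module s by fact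
  show ?thesis
  proof
    show "fps_conv s a (x + y) = fps_conv s a x + fps_conv s a y" for a x y
      by (rule fps_conv_add_right) (simp add: additive_scale assms)
    show "fps_conv s (a + b) x = fps_conv s a x + fps_conv s b x" for a b x
      by (rule fps_conv_add_left) (simp add: additive_scale_left assms)
    have *: "a * b = fps_conv (*) a b" for a b :: "'a fps"
      by (rule fps_ext) (simp add: fps_mult_nth fps_conv_nth)
    show "fps_conv s a (fps_conv s b x) = fps_conv s (a * b) x" for a b x
      unfolding * by (rule fps_conv_assoc[symmetric])
        (simp_all add: additive_scale assms additive_scale_left)
    have "fps_conv s (fps_const 1) x = x" for x
      by (subst fps_conv_const_left) (auto intro!: fps_ext)
    then show "fps_conv s 1 x = x" for x by simp
  qed
qed

lemma fps_conv_scale_const: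
  "module s \<Longrightarrow> fps_nth (fps_conv s (fps_const c) x) n = s c (fps_nth x n)"
  by (subst fps_conv_const_left) (simp_all add: module.scale_zero_left)

lemma fps_conv_scale_X:
  assumes "module s"
  shows "fps_nth (fps_conv s fps_X x) n = (if n = 0 then 0 else fps_nth x (n - 1))"
proof -
  interpret module s by fact
  have "(\<Sum>i=0..n. s (fps_nth fps_X i) (fps_nth x (n - i))) =
      (\<Sum>i\<in>(if n = 0 then {} else {1}). s (fps_nth fps_X i) (fps_nth x (n - i)))"
    by (rule sum.mono_neutral_right) auto
  then show ?thesis by (simp add: fps_conv_nth)
qed

text \<open>Inductions over coefficients rest on this splitting: a linear map lets the factor
  \<lambda> out of the second summand, which lowers the index by one.\<close>

lemma fps_decompose:
  assumes "module s"
  shows "x = fps_const (fps_nth x 0) + fps_conv s fps_X (fps_shift 1 x)"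
  by (rule fps_ext) (simp add: fps_conv_scale_X[OF assms])

lemma module_pointwise:
  assumes "module s"
  shows "module (\<lambda>c f a. s c (f a))"
proof -
  interpret module s by fact
  show ?thesis by standard (auto simp: fun_eq_iff algebra_simps)
qed

lemma module_homI:
  assumes "module s" "module t" "\<And>x y. f (x + y) = f x + f y" "\<And>c x. f (s c x) = t c (f x)"
  shows "module_hom s t f"
  using assms by (simp add: module_hom_def module_hom_axioms_def)

lemma module_hom_modules: "module_hom s t f \<Longrightarrow> module s \<and> module t"
  by (simp add: module_hom_def)

lemma module_hom_comp: "module_hom s t f \<Longrightarrow> module_hom t u g \<Longrightarrow> module_hom s u (\<lambda>x. g (f x))"
  by (simp add: module_hom_def module_hom_axioms_def)

lemma module_hom_plus: "module_hom s t f \<Longrightarrow> module_hom s t g \<Longrightarrow> module_hom s t (\<lambda>x. f x + g x)"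
  by (simp add: module_hom_def module_hom_axioms_def module.scale_right_distrib)

lemma module_hom_minus: "module_hom s t f \<Longrightarrow> module_hom s t g \<Longrightarrow> module_hom s t (\<lambda>x. f x - g x)"
  by (simp add: module_hom_def module_hom_axioms_def module.scale_right_diff_distrib)

lemma module_hom_ident: "module s \<Longrightarrow> module_hom s s (\<lambda>x. x)"
  by (simp add: module_hom_def module_hom_axioms_def)

lemma module_hom_scaled: "module_hom s t f \<Longrightarrow> module_hom s t (\<lambda>x. t c (f x))"
  by (simp add: module_hom_def module_hom_axioms_def module.scale_right_distrib module.scale_left_commute)

lemma module_hom_funpow:
  assumes "module_hom s s f" shows "module_hom s s (f ^^ n)"
  using assms
proof (induction n)
  case 0
  then show ?case using module_hom_ident module_hom_modules by (simp add: id_def) blast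
next
  case (Suc n)
  then show ?case by (simp add: o_def) (rule module_hom_comp)
qed

lemma module_hom_sum:
  assumes "module s" "module t" "\<And>i. i \<in> I \<Longrightarrow> module_hom s t (f i)"
  shows "module_hom s t (\<lambda>x. \<Sum>i\<in>I. f i x)"
  using assms by (simp add: module_hom_def module_hom_axioms_def sum.distrib module.scale_sum_right)

lemma fps_conv_hom:
  assumes "module s" "module t" and "\<And>i. module_hom s t (b (fps_nth G i))"
  shows "module_hom (fps_conv s) (fps_conv t) (fps_conv b G)"
proof (rule module_homI)
  show "fps_conv b G (x + y) = fps_conv b G x + fps_conv b G y" for x y
    by (rule fps_conv_add_right) (simp add: module_hom_additive[OF assms(3)])
  show "fps_conv b G (fps_conv s c x) = fps_conv t c (fps_conv b G x)" for c x
    by (rule fps_conv_left_commute)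
      (simp_all add: module_hom_additive[OF assms(3)] additive_scale assms module_hom.scale[OF assms(3)])
qed (use assms in \<open>simp_all add: module_series\<close>)

lemma fps_map_hom:
  assumes "module_hom s t h"
  shows "module_hom (fps_conv s) (fps_conv t) (fps_map h)"
proof -
  have m: "module s" "module t" using module_hom_modules[OF assms] by auto
  show ?thesis
  proof (rule module_homI)
    show "fps_map h (x + y) = fps_map h x + fps_map h y" for x y
      by (rule fps_ext) (simp add: module_hom.add[OF assms])
    show "fps_map h (fps_conv s c x) = fps_conv t c (fps_map h x)" for c x
      unfolding fps_conv_map_right
      by (rule fps_map_conv) (simp_all add: module_hom_additive[OF assms] module_hom.scale[OF assms])
  qed (use m in \<open>simp_all add: module_series\<close>)
qed

text \<open>\<open>k[[\<lambda>]]\<close>-linearity alone gives \<open>\<lambda>\<close>-adic continuity.\<close>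

lemma series_hom_order:
  assumes "module s" "module t" and hom: "module_hom (fps_conv s) (fps_conv t) \<phi>"
    and "\<forall>i<n. fps_nth x i = 0" "i < n"
  shows "fps_nth (\<phi> x) i = 0"
  using assms(4,5)
proof (induction n arbitrary: x i)
  case (Suc n)
  have "x = fps_conv s fps_X (fps_shift 1 x)"
    using fps_decompose[OF assms(1), of x] Suc.prems by simp
  then have "fps_nth (\<phi> x) i = fps_nth (fps_conv t fps_X (\<phi> (fps_shift 1 x))) i"
    by (metis module_hom.scale[OF hom])
  also have "\<dots> = 0"
    using Suc.IH[of "fps_shift 1 x" "i - 1"] Suc.prems
    by (simp add: fps_conv_scale_X[OF assms(2)])
  finally show ?case .
qed simp

text \<open>Allows an infinite sum to be replaced by a finite truncation before a linear map is
  applied to it, as in \<open>ev_image_nth\<close>.\<close>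

lemma series_hom_cong:
  assumes "module s" "module t" and hom: "module_hom (fps_conv s) (fps_conv t) \<phi>"
    and "\<forall>i\<le>n. fps_nth x i = fps_nth y i"
  shows "fps_nth (\<phi> x) n = fps_nth (\<phi> y) n"
proof -
  have "fps_nth (\<phi> (x - y)) n = 0"
    by (rule series_hom_order[OF assms(1,2) hom, of "Suc n"]) (use assms(4) in auto)
  then show ?thesis by (simp add: module_hom.diff[OF hom])
qed

text \<open>Modulo any power of \<lambda>, a series is a \<open>k[[\<lambda>]]\<close>-combination
  of constants. Identities in several arguments are reduced to constants by one application per
  argument.\<close>

lemma series_hom_eqI:
  assumes "module s" "module t" and hom: "module_hom (fps_conv s) (fps_conv t) \<phi>"
    "module_hom (fps_conv s) (fps_conv t) \<psi>"
    and eq: "\<And>a. \<phi> (fps_const a) = \<psi> (fps_const a)"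
  shows "\<phi> x = \<psi> x"
proof (rule fps_ext)
  fix n show "fps_nth (\<phi> x) n = fps_nth (\<psi> x) n"
  proof (induction n arbitrary: x)
    case 0
    show ?case
      using series_hom_cong[OF assms(1,2) hom(1), of 0 x "fps_const (fps_nth x 0)"]
        series_hom_cong[OF assms(1,2) hom(2), of 0 x "fps_const (fps_nth x 0)"] by (simp add: eq)
  next
    case (Suc n)
    have "fps_nth (\<phi> x) (Suc n) = fps_nth (\<phi> (fps_const (fps_nth x 0)) +
        fps_conv t fps_X (\<phi> (fps_shift 1 x))) (Suc n)"
      by (metis fps_decompose[OF assms(1)] module_hom.add[OF hom(1)] module_hom.scale[OF hom(1)])
    also have "\<dots> = fps_nth (\<psi> (fps_const (fps_nth x 0)) + fps_conv t fps_X (\<psi> (fps_shift 1 x))) (Suc n)"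
      using Suc.IH by (simp add: fps_conv_scale_X[OF assms(2)] eq)
    also have "\<dots> = fps_nth (\<psi> x) (Suc n)"
      by (metis fps_decompose[OF assms(1)] module_hom.add[OF hom(2)] module_hom.scale[OF hom(2)])
    finally show ?case .
  qed
qed

section \<open>Series of functions acting on series\<close>

definition fps_app :: "('u \<Rightarrow> 'v::comm_monoid_add) fps \<Rightarrow> 'u fps \<Rightarrow> 'v fps" where
  "fps_app = fps_conv (\<lambda>f a. f a)"

lemma fps_app_hom:
  assumes "module s" "module t" "\<And>i. module_hom s t (fps_nth G i)"
  shows "module_hom (fps_conv s) (fps_conv t) (fps_app G)"
  unfolding fps_app_def by (rule fps_conv_hom) (use assms in auto)

lemma fps_app_hom_left:
  assumes "module s"
  shows "module_hom (fps_conv (\<lambda>c f a. s c (f a))) (fps_conv s) (\<lambda>G. fps_app G x)"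
proof -
  have *: "(\<lambda>G. fps_app G x) = fps_conv (\<lambda>a f. f a) x"
    unfolding fps_app_def by (rule ext) (rule fps_conv_flip)
  show ?thesis
    by (subst *, rule fps_conv_hom) (auto intro!: module_homI simp: module_pointwise assms)
qed

lemma fps_app_const:
  assumes "module s" "module t" "\<And>i. module_hom s t (fps_nth G i)"
  shows "fps_nth (fps_app G (fps_const a)) n = fps_nth G n a"
proof -
  have "fps_nth (fps_app G (fps_const a)) n = (\<Sum>i\<in>{n}. (fps_nth G i) (fps_nth (fps_const a) (n - i)))"
    unfolding fps_app_def fps_conv_nth
    by (rule sum.mono_neutral_right) (auto simp: module_hom.zero[OF assms(3)])
  then show ?thesis by simp
qed

lemma nth_series_hom:
  assumes "module s" "module t" "module_hom (fps_conv s) (fps_conv t) \<phi>"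
  shows "module_hom s t (\<lambda>a. fps_nth (\<phi> (fps_const a)) n)"
proof (rule module_homI)
  show "fps_nth (\<phi> (fps_const (x + y))) n = fps_nth (\<phi> (fps_const x)) n + fps_nth (\<phi> (fps_const y)) n" for x y
    by (simp add: module_hom.add[OF assms(3)] flip: fps_const_add)
  have "fps_const (s c x) = fps_conv s (fps_const c) (fps_const x)" for c x
    by (rule fps_ext) (simp add: fps_conv_scale_const assms module.scale_zero_right)
  then show "fps_nth (\<phi> (fps_const (s c x))) n = t c (fps_nth (\<phi> (fps_const x)) n)" for c x
    by (simp add: module_hom.scale[OF assms(3)] fps_conv_scale_const assms)
qed (use assms in auto)

text \<open>Linear maps from \<open>V[[\<lambda>]]\<close> to \<open>W[[\<lambda>]]\<close> are
  series of linear maps from \<open>V\<close> to \<open>W\<close>. In this way the logarithm of an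
  automorphism becomes a series of 1-cochains.\<close>

lemma series_hom_eq_fps_app:
  assumes "module s" "module t" "module_hom (fps_conv s) (fps_conv t) \<phi>"
  shows "\<phi> = fps_app (Abs_fps (\<lambda>n a. fps_nth (\<phi> (fps_const a)) n))"
proof
  fix x show "\<phi> x = fps_app (Abs_fps (\<lambda>n a. fps_nth (\<phi> (fps_const a)) n)) x"
    by (rule series_hom_eqI[OF assms(1,2) assms(3) fps_app_hom])
      (auto intro!: fps_ext simp: fps_app_const[OF assms(1,2)] nth_series_hom assms)
qed

section \<open>Power series in a topologically nilpotent operator\<close>

text \<open>This is \<open>f(a) x\<close>. The cut-off at \<open>n\<close> is the one in
  \<open>gauge_act\<close>; the result is the full \<lambda>-adic sum once \<open>a\<close> raises
  the order, as it does in \<open>formal_op\<close>.\<close>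

definition op_series ::
    "('k::comm_ring_1 \<Rightarrow> 'v::ab_group_add \<Rightarrow> 'v) \<Rightarrow> (rat \<Rightarrow> 'k) \<Rightarrow> rat fps \<Rightarrow> ('v fps \<Rightarrow> 'v fps) \<Rightarrow> 'v fps \<Rightarrow> 'v fps"
  where
  "op_series s q f a x = Abs_fps (\<lambda>n. \<Sum>j=0..n. s (q (fps_nth f j)) (fps_nth ((a ^^ j) x) n))"

text \<open>Nilpotency is required only in the form \<open>nth_0\<close>: by linearity a factor
  \<lambda> can be split off repeatedly, so every application of \<open>a\<close> raises the order
  by one (\<open>order\<close>, \<open>funpow_order\<close>).\<close>

locale formal_op =
  fixes s :: "'k::comm_ring_1 \<Rightarrow> 'v::ab_group_add \<Rightarrow> 'v" and q :: "rat \<Rightarrow> 'k" and a :: "'v fps \<Rightarrow> 'v fps"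
  assumes mod: "module s" and rat: "rat_embedding q"
    and hom: "module_hom (fps_conv s) (fps_conv s) a"
    and nth_0: "fps_nth (a x) 0 = 0"
begin

abbreviation ev where "ev f \<equiv> op_series s q f a"

sublocale module s by (rule mod)

lemma order: "\<lbrakk>\<forall>i<n. fps_nth x i = 0; i \<le> n\<rbrakk> \<Longrightarrow> fps_nth (a x) i = 0"
proof (induction n arbitrary: x i)
  case (Suc n)
  have "x = fps_conv s fps_X (fps_shift 1 x)"
    using fps_decompose[OF mod, of x] Suc.prems by simp
  then have "fps_nth (a x) i = fps_nth (fps_conv s fps_X (a (fps_shift 1 x))) i"
    by (metis module_hom.scale[OF hom])
  also have "\<dots> = 0"
    using Suc.IH[of "fps_shift 1 x" "i - 1"] Suc.prems by (simp add: fps_conv_scale_X[OF mod])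
  finally show ?case .
qed (simp add: nth_0)

lemma funpow_order: "\<lbrakk>\<forall>i<l. fps_nth x i = 0; n < l + j\<rbrakk> \<Longrightarrow> fps_nth ((a ^^ j) x) n = 0"
proof (induction j arbitrary: n)
  case (Suc j)
  show ?case
    using order[of "l + j" "(a ^^ j) x" n] Suc by simp
qed auto

lemma funpow_nth_eq_0: "n < j \<Longrightarrow> fps_nth ((a ^^ j) x) n = 0"
  using funpow_order[of 0 x n j] by simp

text \<open>A free bound \<open>N\<close> gives all coefficients up to \<open>N\<close> one common
  range of summation, so that sums can be interchanged and truncations compared.\<close>

lemma ev_nth:
  assumes "n \<le> N"
  shows "fps_nth (ev f x) n = (\<Sum>j=0..N. s (q (fps_nth f j)) (fps_nth ((a ^^ j) x) n))"
  unfolding op_series_def fps_nth_Abs_fps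
  by (rule sum.mono_neutral_left) (use assms in \<open>auto simp: funpow_nth_eq_0\<close>)

lemma funpow_hom: "module_hom (fps_conv s) (fps_conv s) (a ^^ j)"
  by (rule module_hom_funpow[OF hom])

text \<open>Up to coefficient \<open>n\<close>, \<open>ev f\<close> agrees with a polynomial in
  \<open>a\<close>, and that polynomial is linear.\<close>

lemma ev_hom: "module_hom (fps_conv s) (fps_conv s) (ev f)"
proof -
  have *: "fps_nth (ev f x) n =
      fps_nth (\<Sum>j=0..n. fps_conv s (fps_const (q (fps_nth f j))) ((a ^^ j) x)) n" for x n
    by (simp add: ev_nth[of n n] fps_sum_nth fps_conv_scale_const mod)
  have h: "module_hom (fps_conv s) (fps_conv s)
      (\<lambda>x. \<Sum>j=0..n. fps_conv s (fps_const (q (fps_nth f j))) ((a ^^ j) x))" for n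
    by (intro module_hom_sum module_hom_scaled funpow_hom module_series mod)
  show ?thesis
  proof (rule module_homI)
    show "ev f (x + y) = ev f x + ev f y" for x y
      by (rule fps_ext) (simp only: * module_hom.add[OF h] fps_add_nth)
    show "ev f (fps_conv s c x) = fps_conv s c (ev f x)" for c x
    proof (rule fps_ext)
      fix n
      have "fps_nth (ev f (fps_conv s c x)) n = fps_nth (fps_conv s c
          (\<Sum>j=0..n. fps_conv s (fps_const (q (fps_nth f j))) ((a ^^ j) x))) n"
        by (simp only: * module_hom.scale[OF h])
      also have "\<dots> = fps_nth (fps_conv s c (ev f x)) n"
      proof -
        \<comment> \<open>Multiplication by \<open>c\<close> mixes all lower coefficients, so the
          polynomial cut off at \<open>n\<close> has to be correct at each \<open>n - i\<close> as
          well.\<close>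
        have "fps_nth (\<Sum>j=0..n. fps_conv s (fps_const (q (fps_nth f j))) ((a ^^ j) x)) (n - i) =
            fps_nth (ev f x) (n - i)" for i
          by (simp add: ev_nth[of _ n] fps_sum_nth fps_conv_scale_const mod)
        then show ?thesis by (simp only: fps_conv_nth[of s c])
      qed
      finally show "fps_nth (ev f (fps_conv s c x)) n = fps_nth (fps_conv s c (ev f x)) n" .
    qed
  qed (simp_all add: module_series mod)
qed

lemma ev_image_nth:
  assumes "module t" and \<phi>: "module_hom (fps_conv s) (fps_conv t) \<phi>"
  shows "fps_nth (\<phi> (ev f x)) n = (\<Sum>j=0..n. t (q (fps_nth f j)) (fps_nth (\<phi> ((a ^^ j) x)) n))"
proof -
  have "fps_nth (\<phi> (ev f x)) n =
      fps_nth (\<phi> (\<Sum>j=0..n. fps_conv s (fps_const (q (fps_nth f j))) ((a ^^ j) x))) n"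
    by (rule series_hom_cong[OF mod assms])
      (simp add: ev_nth[of _ n] fps_sum_nth fps_conv_scale_const mod)
  then show ?thesis
    by (simp add: module_hom.sum[OF \<phi>] module_hom.scale[OF \<phi>] fps_sum_nth fps_conv_scale_const assms)
qed

text \<open>Powers of \<open>a\<close> multiply by adding exponents. With \<open>ev_1\<close>,
  \<open>ev_add\<close> and \<open>ev_X\<close> this makes \<open>f \<mapsto> f(a)\<close> a ring
  homomorphism, which turns identities of rational power series into identities of
  operators.\<close>

lemma ev_ev: "ev f (ev g x) = ev (f * g) x"
proof (rule fps_ext)
  fix n
  define h where "h i j = s (q (fps_nth f i * fps_nth g j)) (fps_nth ((a ^^ (i + j)) x) n)" for i j
  have "fps_nth (ev f (ev g x)) n = (\<Sum>i=0..n. \<Sum>j=0..n. h i j)"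
    by (subst ev_nth[of n n]) (auto intro!: sum.cong simp: ev_image_nth[OF mod funpow_hom] h_def
      scale_sum_right rat_embedding_simps[OF rat] funpow_add)
  \<comment> \<open>Terms with \<open>i + j > n\<close> vanish because the power
    \<open>i + j\<close> of \<open>a\<close> raises the order by that much.\<close>
  also have "\<dots> = (\<Sum>i=0..n. \<Sum>j=0..n-i. h i j)"
    by (intro sum.cong sum.mono_neutral_right) (auto simp: h_def funpow_nth_eq_0)
  also have "\<dots> = (\<Sum>m=0..n. \<Sum>i=0..m. h i (m - i))"
    using fps_mult_assoc_lemma[of "\<lambda>i j _. h i j" n n] by simp
  also have "\<dots> = fps_nth (ev (f * g) x) n"
    by (subst ev_nth[of n n]) (auto intro!: sum.cong simp: h_def fps_mult_nth
      rat_embedding_simps[OF rat] scale_sum_left)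
  finally show "fps_nth (ev f (ev g x)) n = fps_nth (ev (f * g) x) n" .
qed

lemma ev_1: "ev 1 x = x"
proof (rule fps_ext)
  fix n
  have "fps_nth (ev 1 x) n = (\<Sum>j\<in>{0}. s (q (fps_nth 1 j)) (fps_nth ((a ^^ j) x) n))"
    unfolding op_series_def fps_nth_Abs_fps
    by (rule sum.mono_neutral_right) (auto simp: rat_embedding_simps[OF rat])
  then show "fps_nth (ev 1 x) n = fps_nth x n"
    by (simp add: rat_embedding_simps[OF rat])
qed

lemma ev_X: "ev fps_X x = a x"
proof (rule fps_ext)
  fix n
  have "fps_nth (ev fps_X x) n = (\<Sum>j\<in>{1}. s (q (fps_nth fps_X j)) (fps_nth ((a ^^ j) x) n))"
    \<comment> \<open>The bound \<open>Suc n\<close> keeps the index 1 in range for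
      \<open>n = 0\<close>.\<close>
    by (subst ev_nth[of n "Suc n"], simp, rule sum.mono_neutral_right)
      (auto simp: rat_embedding_simps[OF rat])
  then show "fps_nth (ev fps_X x) n = fps_nth (a x) n"
    by (simp add: rat_embedding_simps[OF rat])
qed

lemma ev_add: "ev (f + g) x = ev f x + ev g x"
  by (rule fps_ext) (simp add: ev_nth[of _ _] op_series_def rat_embedding_simps[OF rat] scale_left_distrib sum.distrib)

lemma ev_nth_0: "fps_nth (ev f x) 0 = s (q (fps_nth f 0)) (fps_nth x 0)"
  by (simp add: op_series_def)

lemma ev_funpow: "(ev g ^^ j) x = ev (g ^ j) x"
  by (induction j) (simp_all add: ev_1 ev_ev)

text \<open>Since \<open>g\<close> has no constant term, \<open>g ^ j\<close> starts at order
  \<open>j\<close>, and the sum for coefficient \<open>i\<close> of the composite may run to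
  \<open>n\<close> instead of \<open>i\<close>.\<close>

lemma ev_compose:
  assumes "fps_nth g 0 = 0"
  shows "op_series s q f (ev g) x = ev (f oo g) x"
proof (rule fps_ext)
  fix n
  have "fps_nth (op_series s q f (ev g) x) n =
      (\<Sum>j=0..n. \<Sum>i=0..n. s (q (fps_nth f j * fps_nth (g ^ j) i)) (fps_nth ((a ^^ i) x) n))"
    unfolding op_series_def[of s q f "ev g"]
    by (simp add: ev_funpow ev_nth[of n n] scale_sum_right rat_embedding_simps[OF rat])
  also have "\<dots> = (\<Sum>i=0..n. s (q (\<Sum>j=0..n. fps_nth f j * fps_nth (g ^ j) i)) (fps_nth ((a ^^ i) x) n))"
    by (subst sum.swap) (simp add: rat_embedding_simps[OF rat] scale_sum_left)
  also have "\<dots> = (\<Sum>i=0..n. s (q (fps_nth (f oo g) i)) (fps_nth ((a ^^ i) x) n))"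
  proof (intro sum.cong refl arg_cong2[where f=s] arg_cong[where f=q])
    fix i assume "i \<in> {0..n}"
    then show "(\<Sum>j=0..n. fps_nth f j * fps_nth (g ^ j) i) = fps_nth (f oo g) i"
      unfolding fps_compose_nth
      by (intro sum.mono_neutral_right) (auto simp: startsby_zero_power_prefix[OF assms])
  qed
  finally show "fps_nth (op_series s q f (ev g) x) n = fps_nth (ev (f oo g) x) n"
    by (simp add: ev_nth[of n n])
qed

text \<open>Applied to \<open>sub0 A\<close>, so that exponentials and logarithms respect the ideal,
  and to the set of bilinear maps, so that conjugated products stay bilinear.\<close>

lemma ev_closed:
  assumes U: "subspace U" and a: "\<And>x. \<forall>n. fps_nth x n \<in> U \<Longrightarrow> \<forall>n. fps_nth (a x) n \<in> U"
    and x: "\<forall>n. fps_nth x n \<in> U"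
  shows "fps_nth (ev f x) n \<in> U"
proof -
  have "\<forall>n. fps_nth ((a ^^ j) x) n \<in> U" for j
    by (induction j) (use a x in auto)
  then show ?thesis
    unfolding op_series_def fps_nth_Abs_fps by (intro subspace_sum subspace_scale U) auto
qed

end

text \<open>Term by term comparison in a common target. It moves an exponential from an argument of
  a product to the product itself: \<phi> varies the argument, \<psi> varies the product.\<close>

lemma op_series_transfer:
  assumes "formal_op s q a" "formal_op t q b" "module u"
    and "module_hom (fps_conv s) (fps_conv u) \<phi>" "module_hom (fps_conv t) (fps_conv u) \<psi>"
    and "\<And>j. \<phi> ((a ^^ j) x) = \<psi> ((b ^^ j) y)"
  shows "\<phi> (op_series s q f a x) = \<psi> (op_series t q f b y)"
  by (rule fps_ext) (simp add: formal_op.ev_image_nth[OF assms(1) assms(3,4)]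
      formal_op.ev_image_nth[OF assms(2) assms(3,5)] assms(6))

lemma op_series_intertwine:
  assumes "formal_op s q a" "formal_op t q b"
    and "module_hom (fps_conv s) (fps_conv t) \<phi>" "\<And>x. \<phi> (a x) = b (\<phi> x)"
  shows "\<phi> (op_series s q f a x) = op_series t q f b (\<phi> x)"
proof -
  have "\<phi> ((a ^^ j) x) = (b ^^ j) (\<phi> x)" for j
    by (induction j) (simp_all add: assms(4))
  then show ?thesis
    using op_series_transfer[OF assms(1,2) formal_op.mod[OF assms(2)] assms(3)
      module_hom_ident, of x "\<phi> x" f] formal_op.mod[OF assms(2)]
    by (simp add: module_series)
qed

section \<open>Commuting operators: binomial theorem, exponential and logarithm\<close>

lemma choose_sum_Suc:
  assumes "module s"
  shows "(\<Sum>i=0..Suc m. s (of_nat (Suc m choose i)) (t i (Suc m - i))) =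
    (\<Sum>i=0..m. s (of_nat (m choose i)) (t (Suc i) (m - i) + t i (Suc (m - i))))"
proof -
  interpret module s by fact
  have "(\<Sum>i=0..m. s (of_nat (m choose i)) (t i (Suc (m - i)))) =
      (\<Sum>i=0..Suc m. s (of_nat (m choose i)) (t i (Suc m - i)))"
    by (simp add: Suc_diff_le binomial_eq_0)
  also have "\<dots> = t 0 (Suc m) + (\<Sum>i=0..m. s (of_nat (m choose Suc i)) (t (Suc i) (m - i)))"
    by (subst sum.atLeast0_atMost_Suc_shift) simp
  finally show ?thesis
    by (subst sum.atLeast0_atMost_Suc_shift)
      (simp add: scale_left_distrib scale_right_distrib sum.distrib)
qed

lemma funpow_binomial:
  assumes "module s" "\<And>x y. a (x + y) = a x + a y" "\<And>c x. a (s c x) = s c (a x)"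
    "\<And>x y. b (x + y) = b x + b y" "\<And>c x. b (s c x) = s c (b x)"
    and comm: "\<And>x. a (b x) = b (a x)"
  shows "((\<lambda>x. a x + b x) ^^ m) x =
    (\<Sum>i=0..m. s (of_nat (m choose i)) ((a ^^ i) ((b ^^ (m - i)) x)))"
proof (induction m)
  case 0
  show ?case using assms(1) by (simp add: module.scale_one)
next
  case (Suc m)
  interpret module s by fact
  have a: "module_hom s s a" and b: "module_hom s s b"
    using assms by (auto intro!: module_homI)
  have ba: "b ((a ^^ i) y) = (a ^^ i) (b y)" for i y
    by (induction i) (simp_all add: comm[symmetric])
  show ?case
    unfolding choose_sum_Suc[OF assms(1), of m "\<lambda>i j. (a ^^ i) ((b ^^ j) x)"]
    by (simp add: Suc module_hom.sum[OF a] module_hom.sum[OF b] assms(3,5) ba sum.distrib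
      scale_right_distrib)
qed

lemma of_nat_rat_embedding:
  assumes "rat_embedding q" shows "of_nat n = q (of_nat n)"
  by (induction n) (simp_all add: rat_embedding_simps[OF assms])

lemma op_exp_add:
  assumes a: "formal_op s q a" and b: "formal_op s q b" and comm: "\<And>x. a (b x) = b (a x)"
  shows "formal_op s q (\<lambda>x. a x + b x)"
    and "op_series s q (fps_exp 1) (\<lambda>x. a x + b x) x =
      op_series s q (fps_exp 1) a (op_series s q (fps_exp 1) b x)"
proof -
  interpret a: formal_op s q a by fact
  interpret b: formal_op s q b by fact
  show ab: "formal_op s q (\<lambda>x. a x + b x)"
    by (simp add: formal_op_def module_hom_plus a.hom b.hom a.mod a.rat a.nth_0 b.nth_0)
  interpret ab: formal_op s q "\<lambda>x. a x + b x" by fact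
  show "op_series s q (fps_exp 1) (\<lambda>x. a x + b x) x =
      op_series s q (fps_exp 1) a (op_series s q (fps_exp 1) b x)"
  proof (rule fps_ext)
    fix n
    define h where "h i j = s (q (1 / fact i * (1 / fact j))) (fps_nth ((a ^^ i) ((b ^^ j) x)) n)" for i j
    have h: "h i j = s (q (1 / fact i)) (s (q (1 / fact j)) (fps_nth ((a ^^ i) ((b ^^ j) x)) n))" for i j
      unfolding h_def rat_embedding_simps(4)[OF a.rat] by simp
    have c: "fps_nth (fps_conv s (of_nat m) x) n = s (of_nat m) (fps_nth x n)" for m n x
      by (simp add: fps_of_nat[symmetric] fps_conv_scale_const a.mod)
    \<comment> \<open>The binomial coefficient in \<open>k\<close> is the image of the rational one,
      so the factorials cancel in \<open>rat\<close>.\<close>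
    have q: "q (1 / fact m) * of_nat (m choose i) = q (1 / fact i * (1 / fact (m - i)))"
      if "i \<le> m" for m i
      unfolding of_nat_rat_embedding[OF a.rat] rat_embedding_simps(4)[OF a.rat, symmetric]
      using that by (simp add: binomial_fact field_simps)
    have pw: "((\<lambda>x. a x + b x) ^^ m) x =
      (\<Sum>i=0..m. fps_conv s (of_nat (m choose i)) ((a ^^ i) ((b ^^ (m - i)) x)))" for m
      by (rule funpow_binomial) (simp_all add: module_series a.mod module_hom.add[OF a.hom]
        module_hom.scale[OF a.hom] module_hom.add[OF b.hom] module_hom.scale[OF b.hom] comm)
    have "fps_nth (op_series s q (fps_exp 1) (\<lambda>x. a x + b x) x) n = (\<Sum>m=0..n. \<Sum>i=0..m. h i (m - i))"
      by (subst ab.ev_nth[of n n]) (auto intro!: sum.cong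
        simp: pw fps_sum_nth c a.scale_sum_right q h_def)
    also have "\<dots> = (\<Sum>i=0..n. \<Sum>j=0..n-i. h i j)"
      using fps_mult_assoc_lemma[of "\<lambda>i j _. h i j" n n] by simp
    also have "\<dots> = (\<Sum>i=0..n. \<Sum>j=0..n. h i j)"
    proof -
      \<comment> \<open>\<open>b\<close> raises the order by \<open>j\<close> and \<open>a\<close>
        by a further \<open>i\<close>, so the triangle is completed to a square by zeros.\<close>
      have "fps_nth ((a ^^ i) ((b ^^ j) x)) n = 0" if "n < j + i" for i j
        using that by (intro a.funpow_order[of j]) (auto simp: b.funpow_nth_eq_0)
      then show ?thesis
        by (intro sum.cong sum.mono_neutral_left) (auto simp: h_def)
    qed
    also have "\<dots> = fps_nth (op_series s q (fps_exp 1) a (op_series s q (fps_exp 1) b x)) n"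
      by (subst a.ev_nth[of n n]) (auto intro!: sum.cong simp: b.ev_image_nth[OF a.mod a.funpow_hom]
        h a.scale_sum_right simp del: a.scale_scale)
    finally show "fps_nth (op_series s q (fps_exp 1) (\<lambda>x. a x + b x) x) n =
      fps_nth (op_series s q (fps_exp 1) a (op_series s q (fps_exp 1) b x)) n" .
  qed
qed

text \<open>This is log (1 + X). As the compositional inverse of exp X - 1 it yields
  \<open>exp_log\<close> without reference to its coefficients.\<close>

definition log_series :: "rat fps" where "log_series = fps_inv (fps_exp 1 - 1)"

lemma log_series_0: "fps_nth log_series 0 = 0"
  by (simp add: log_series_def fps_inv_def)

lemma op_series_cong:
  assumes "\<And>j. (a ^^ j) x = (b ^^ j) x"
  shows "op_series s q f a x = op_series s q f b x"
  by (simp add: op_series_def assms)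

lemma op_series_map:
  assumes "module_hom s t h" "\<And>x. fps_map h (a x) = b (fps_map h x)"
  shows "fps_map h (op_series s q f a x) = op_series t q f b (fps_map h x)"
proof -
  have "(b ^^ j) (fps_map h x) = fps_map h ((a ^^ j) x)" for j
    by (induction j) (simp_all add: assms(2))
  then show ?thesis
    by (intro fps_ext) (simp add: op_series_def module_hom.sum[OF assms(1)] module_hom.scale[OF assms(1)])
qed

context formal_op
begin

text \<open>For \<open>y\<close> the undeformed product, \<open>- a y\<close> is the differential of
  the gauge parameter. The subtracted sum is then minus the part \<open>j \<ge> 1\<close> of the
  exponential series at \<open>y\<close>, and adding \<open>y\<close> supplies the term
  \<open>j = 0\<close>.\<close>

lemma exp_add_const:
  "y + (ev (fps_exp 1) x - Abs_fps (\<lambda>n. \<Sum>j=0..n. s (q (1 / fact (1 + j))) (fps_nth ((a ^^ j) (- a y)) n))) =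
    ev (fps_exp 1) (y + x)"
proof -
  have neg: "(a ^^ j) (- z) = - (a ^^ j) z" for j z
    by (rule module_hom.neg[OF funpow_hom])
  have "y - Abs_fps (\<lambda>n. \<Sum>j=0..n. s (q (1 / fact (1 + j))) (fps_nth ((a ^^ j) (- a y)) n)) =
    ev (fps_exp 1) y"
  proof (rule fps_ext)
    fix n
    \<comment> \<open>With the bound \<open>Suc n\<close>, splitting off \<open>j = 0\<close> leaves
      exactly the range \<open>0..n\<close> of the gauge term.\<close>
    have "fps_nth (ev (fps_exp 1) y) n = (\<Sum>j=0..Suc n. s (q (1 / fact j)) (fps_nth ((a ^^ j) y) n))"
      by (subst ev_nth[of n "Suc n"]) simp_all
    also have "\<dots> = fps_nth y n + (\<Sum>j=0..n. s (q (1 / fact (1 + j))) (fps_nth ((a ^^ Suc j) y) n))"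
      by (subst sum.atLeast0_atMost_Suc_shift) (simp add: rat_embedding_simps[OF rat])
    finally show "fps_nth (y - Abs_fps (\<lambda>n. \<Sum>j=0..n. s (q (1 / fact (1 + j))) (fps_nth ((a ^^ j) (- a y)) n))) n =
        fps_nth (ev (fps_exp 1) y) n"
      by (simp add: neg sum_negf funpow_swap1)
  qed
  then show ?thesis
    unfolding module_hom.add[OF ev_hom] by (simp add: algebra_simps)
qed

lemma exp_inverse: "ev (fps_exp 1) (ev (fps_exp (- 1)) x) = x" "ev (fps_exp (- 1)) (ev (fps_exp 1) x) = x"
  using fps_exp_add_mult[of "1::rat" "-1"] fps_exp_add_mult[of "-1::rat" "1"] by (simp_all add: ev_ev ev_1)

text \<open>The geometric series in \<open>a\<close> inverts \<open>1 + a\<close> on both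
  sides.\<close>

lemma one_plus_inverse:
  "ev (inverse (1 + fps_X)) (x + a x) = x"
  "ev (inverse (1 + fps_X)) x + a (ev (inverse (1 + fps_X)) x) = x"
proof -
  have 1: "y + a y = ev (1 + fps_X) y" for y
    by (simp add: ev_add ev_1 ev_X)
  show "ev (inverse (1 + fps_X)) (x + a x) = x"
    "ev (inverse (1 + fps_X)) x + a (ev (inverse (1 + fps_X)) x) = x"
    unfolding 1 by (simp_all add: ev_ev inverse_mult_eq_1 inverse_mult_eq_1' ev_1)
qed

lemma exp_log: "op_series s q (fps_exp 1) (ev log_series) x = x + a x"
proof -
  have "fps_exp 1 oo log_series = ((fps_exp 1 - 1) oo log_series) + (1 :: rat fps)"
    by (simp add: fps_compose_sub_distrib)
  also have "\<dots> = 1 + fps_X"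
    by (simp add: log_series_def fps_inv_fps_exp_compose)
  finally show ?thesis
    by (simp add: ev_compose log_series_0 ev_add ev_1 ev_X)
qed

end

section \<open>Conjugation of a bilinear product by an exponential\<close>

lemma sum_fun_apply: "(\<Sum>i\<in>I. f i) x = (\<Sum>i\<in>I. f i x)"
  for f :: "'i \<Rightarrow> 'a \<Rightarrow> 'b::comm_monoid_add"
  by (induction I rule: infinite_finite_induct) auto

definition bihom :: "('k::comm_ring_1 \<Rightarrow> 'v::ab_group_add \<Rightarrow> 'v) \<Rightarrow> ('v \<Rightarrow> 'v \<Rightarrow> 'v) \<Rightarrow> bool" where
  "bihom s f \<longleftrightarrow> (\<forall>y. module_hom s s (\<lambda>x. f x y)) \<and> (\<forall>x. module_hom s s (f x))"

abbreviation (input) scale1 :: "('k \<Rightarrow> 'v \<Rightarrow> 'v) \<Rightarrow> 'k \<Rightarrow> ('a \<Rightarrow> 'v) \<Rightarrow> 'a \<Rightarrow> 'v" where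
  "scale1 s \<equiv> \<lambda>c f x. s c (f x)"

abbreviation (input) scale2 :: "('k \<Rightarrow> 'v \<Rightarrow> 'v) \<Rightarrow> 'k \<Rightarrow> ('a \<Rightarrow> 'b \<Rightarrow> 'v) \<Rightarrow> 'a \<Rightarrow> 'b \<Rightarrow> 'v" where
  "scale2 s \<equiv> \<lambda>c f x y. s c (f x y)"

lemma module_scale2: "module s \<Longrightarrow> module (scale2 s)"
  by (rule module_pointwise[OF module_pointwise])

lemma bihom_homs: "bihom s f \<Longrightarrow> module_hom s s (\<lambda>x. f x y)" "bihom s f \<Longrightarrow> module_hom s s (f x)"
  by (simp_all add: bihom_def)

lemma bihom_zero: "bihom s f \<Longrightarrow> f 0 y = 0" "bihom s f \<Longrightarrow> f x 0 = 0"
  using module_hom.zero[OF bihom_homs(1)[of s f y]] module_hom.zero[OF bihom_homs(2)[of s f x]] by auto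

lemma bihom_add: "bihom s f \<Longrightarrow> f (x + x') y = f x y + f x' y" "bihom s f \<Longrightarrow> f x (y + y') = f x y + f x y'"
  using module_hom.add[OF bihom_homs(1)[of s f y], of x x'] module_hom.add[OF bihom_homs(2)[of s f x], of y y']
  by auto

lemma bihom_scale: "bihom s f \<Longrightarrow> f (s c x) y = s c (f x y)" "bihom s f \<Longrightarrow> f x (s c y) = s c (f x y)"
  using module_hom.scale[OF bihom_homs(1)[of s f y], of c x] module_hom.scale[OF bihom_homs(2)[of s f x], of c y]
  by auto

lemma bihom_scale1: "module s \<Longrightarrow> bihom s f \<Longrightarrow> module_hom s (scale1 s) f"
  by (intro module_homI module_pointwise ext) (simp_all add: bihom_add bihom_scale)

lemma subspace_bihom:
  assumes "module s" shows "module.subspace (scale2 s) {f. bihom s f}"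
proof -
  interpret m: module "scale2 s" by (rule module_scale2[OF assms])
  have [simp]: "module_hom s s (\<lambda>x. 0)"
    using assms by (auto intro!: module_homI simp: module.scale_zero_right)
  show ?thesis
    by (auto simp: m.subspace_def bihom_def plus_fun_def zero_fun_def
        intro!: module_hom_plus module_hom_scaled)
qed

text \<open>Written as two successive evaluations, so that linearity in each argument comes from
  \<open>fps_app\<close>; \<open>bilin_ext_eq_bil\<close> identifies it with
  \<open>bilin_ext\<close>.\<close>

definition fps_bil :: "('u \<Rightarrow> 'v \<Rightarrow> 'w::comm_monoid_add) fps \<Rightarrow> 'u fps \<Rightarrow> 'v fps \<Rightarrow> 'w fps" where
  "fps_bil B x y = fps_app (fps_app B x) y"

lemma fps_bil_hom_left:
  assumes "module s" "\<And>i. bihom s (fps_nth B i)"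
  shows "module_hom (fps_conv s) (fps_conv s) (\<lambda>x. fps_bil B x y)"
  unfolding fps_bil_def
  by (rule module_hom_comp[OF fps_app_hom fps_app_hom_left])
    (simp_all add: assms module_pointwise bihom_scale1)

lemma fps_app_bihom:
  assumes "module s" "\<And>i. bihom s (fps_nth B i)"
  shows "module_hom s s (fps_nth (fps_app B x) i)"
proof -
  have "fps_nth (fps_app B x) i = (\<lambda>y. \<Sum>j=0..i. fps_nth B j (fps_nth x (i - j)) y)"
    by (simp add: fun_eq_iff fps_app_def fps_conv_nth sum_fun_apply)
  then show ?thesis
    using assms by (auto intro!: module_hom_sum simp: bihom_def)
qed

lemma fps_bil_hom_right:
  assumes "module s" "\<And>i. bihom s (fps_nth B i)"
  shows "module_hom (fps_conv s) (fps_conv s) (fps_bil B x)"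
  unfolding fps_bil_def by (rule fps_app_hom) (auto intro: assms fps_app_bihom)

lemma fps_bil_bihom:
  assumes "module s" "\<And>i. bihom s (fps_nth B i)"
  shows "bihom (fps_conv s) (fps_bil B)"
  unfolding bihom_def using fps_bil_hom_left[OF assms] fps_bil_hom_right[OF assms] by blast

lemma fps_bil_hom:
  assumes "module s"
  shows "module_hom (fps_conv (scale2 s)) (fps_conv s) (\<lambda>B. fps_bil B x y)"
  unfolding fps_bil_def
  by (rule module_hom_comp[OF fps_app_hom_left[OF module_pointwise] fps_app_hom_left]) (simp_all add: assms)

text \<open>Products of constants reveal the coefficients of \<open>B\<close>; equality of products
  thereby becomes equality of series.\<close>

lemma fps_bil_const:
  assumes "module s" "\<And>i. bihom s (fps_nth B i)"
  shows "fps_nth (fps_bil B (fps_const x) (fps_const y)) n = fps_nth B n x y"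
  unfolding fps_bil_def
  by (subst fps_app_const[of s s]) (simp_all add: assms fps_app_bihom bihom_homs
    fps_app_const[OF assms(1) module_pointwise[OF assms(1)] bihom_scale1[OF assms]])

text \<open>The Gerstenhaber bracket of a 1-cochain with a 2-cochain, on curried maps.\<close>

definition lin_bracket :: "('v \<Rightarrow> 'v) \<Rightarrow> ('v \<Rightarrow> 'v \<Rightarrow> 'v::ab_group_add) \<Rightarrow> 'v \<Rightarrow> 'v \<Rightarrow> 'v" where
  "lin_bracket g f = (\<lambda>x y. g (f x y) - f (g x) y - f x (g y))"

text \<open>Precomposition with the zero map annihilates only those functions that vanish at \<open>0\<close>. Setting it
  to zero by hand makes the operators below topologically nilpotent on all functions.\<close>

definition post :: "('v \<Rightarrow> 'v) \<Rightarrow> ('v \<Rightarrow> 'v \<Rightarrow> 'v) \<Rightarrow> 'v \<Rightarrow> 'v \<Rightarrow> 'v" where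
  "post g f = (\<lambda>x y. g (f x y))"
definition pre1 :: "('v::zero \<Rightarrow> 'v) \<Rightarrow> ('v \<Rightarrow> 'v \<Rightarrow> 'v) \<Rightarrow> 'v \<Rightarrow> 'v \<Rightarrow> 'v" where
  "pre1 g f = (if g = 0 then 0 else (\<lambda>x y. f (g x) y))"
definition pre2 :: "('v::zero \<Rightarrow> 'v) \<Rightarrow> ('v \<Rightarrow> 'v \<Rightarrow> 'v) \<Rightarrow> 'v \<Rightarrow> 'v \<Rightarrow> 'v" where
  "pre2 g f = (if g = 0 then 0 else (\<lambda>x y. f x (g y)))"

text \<open>One component of a gauge parameter: \<gamma> is any series of linear maps without
  constant term, acting on products through \<open>ad\<close>. The variant \<open>ad'\<close> agrees
  with \<open>ad\<close> on series of bilinear maps (\<open>ad_eq\<close>) and is a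
  \<open>formal_op\<close> on all functions.\<close>

locale formal_derivation =
  fixes s :: "'k::comm_ring_1 \<Rightarrow> 'v::ab_group_add \<Rightarrow> 'v" and q :: "rat \<Rightarrow> 'k" and \<gamma> :: "('v \<Rightarrow> 'v) fps"
  assumes mod: "module s" and rat: "rat_embedding q"
    and hom: "module_hom s s (fps_nth \<gamma> i)" and nth_0: "fps_nth \<gamma> 0 = 0"
begin

abbreviation "ad \<equiv> fps_conv lin_bracket \<gamma>"
abbreviation "Post \<equiv> fps_conv post \<gamma>"
abbreviation "Pre1 \<equiv> fps_conv pre1 \<gamma>"
abbreviation "Pre2 \<equiv> fps_conv pre2 \<gamma>"
abbreviation "ad' B \<equiv> Post B - Pre1 B - Pre2 B"
abbreviation "Exp \<equiv> op_series s q (fps_exp 1) (fps_app \<gamma>)"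

lemma zero [simp]: "fps_nth \<gamma> i 0 = 0"
  by (rule module_hom.zero[OF hom])

lemma hom_ops: "module_hom (scale2 s) (scale2 s) (post (fps_nth \<gamma> i))"
  "module_hom (scale2 s) (scale2 s) (pre1 g)"
  "module_hom (scale2 s) (scale2 s) (pre2 g)"
  by (auto intro!: module_homI simp: module_scale2 mod post_def pre1_def pre2_def fun_eq_iff
      module_hom.add[OF hom] module_hom.scale[OF hom] module.scale_zero_right)

lemma formal_op_app: "formal_op s q (fps_app \<gamma>)"
  by (simp add: formal_op_def mod rat fps_app_hom hom) (simp add: fps_app_def fps_conv_nth nth_0)

lemma formal_op_Post: "formal_op (scale2 s) q Post"
  and formal_op_Pre1: "formal_op (scale2 s) q Pre1"
  and formal_op_Pre2: "formal_op (scale2 s) q Pre2"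
  by (simp_all add: formal_op_def module_scale2 mod rat fps_conv_hom hom_ops)
    (simp_all add: fps_conv_nth nth_0 fun_eq_iff post_def pre1_def pre2_def)

sublocale app: formal_op s q "fps_app \<gamma>" by (rule formal_op_app)
sublocale Post: formal_op "scale2 s" q Post by (rule formal_op_Post)
sublocale Pre1: formal_op "scale2 s" q Pre1 by (rule formal_op_Pre1)
sublocale Pre2: formal_op "scale2 s" q Pre2 by (rule formal_op_Pre2)

lemma additive_ops: "additive (post (fps_nth \<gamma> i))" "additive (pre1 g)" "additive (pre2 g)"
  for g :: "'v \<Rightarrow> 'v"
  by (simp_all add: hom_ops[THEN module_hom_additive])

text \<open>\<open>Post\<close> acts on the value and the two \<open>Pre\<close> operators on
  different arguments. When a precomposition is zero by convention, both sides vanish because each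
  coefficient of \<gamma> maps 0 to 0.\<close>

lemma commute:
  "Pre1 (Post B) = Post (Pre1 B)" "Pre2 (Post B) = Post (Pre2 B)" "Pre1 (Pre2 B) = Pre2 (Pre1 B)"
  by (rule fps_conv_left_commute, rule additive_ops, rule additive_ops,
      simp add: pre1_def post_def pre2_def fun_eq_iff)+

lemma formal_op_ad': "formal_op (scale2 s) q ad'"
  by (simp add: formal_op_def module_scale2 mod rat module_hom_minus fps_conv_hom hom_ops
      Post.nth_0 Pre1.nth_0 Pre2.nth_0)

sublocale ad': formal_op "scale2 s" q ad' by (rule formal_op_ad')

text \<open>Solved for \<open>Post\<close> rather than for \<open>ad'\<close>, so that only
  exponentials with positive sign occur.\<close>

lemma exp_Post: "Post.ev (fps_exp 1) B = Pre1.ev (fps_exp 1) (Pre2.ev (fps_exp 1) (ad'.ev (fps_exp 1) B))"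
proof -
  have 2: "Pre2 (ad' B) = ad' (Pre2 B)" for B
    by (simp only: module_hom.diff[OF Pre2.hom] commute)
  note e2 = op_exp_add[OF formal_op_Pre2 formal_op_ad', OF 2]
  have 1: "Pre1 (Pre2 B + ad' B) = Pre2 (Pre1 B) + ad' (Pre1 B)" for B
    by (simp only: module_hom.diff[OF Pre1.hom] module_hom.add[OF Pre1.hom] commute)
  note e1 = op_exp_add(2)[OF formal_op_Pre1 e2(1), OF 1]
  have "(\<lambda>B. Pre1 B + (Pre2 B + ad' B)) = Post"
    by (rule ext) (simp add: algebra_simps)
  then show ?thesis using e1[of B] e2(2)[of B] by (simp only:)
qed

lemma bil_Post: "fps_bil (Post B) x y = fps_app \<gamma> (fps_bil B x y)"
proof -
  have a: "additive (\<lambda>h y. fps_nth \<gamma> i (h y))" "additive (fps_nth \<gamma> i)" for i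
    by (auto simp: additive_def fun_eq_iff module_hom.add[OF hom])
  have a': "additive (\<lambda>f. f x)" for x :: 'v and f :: "'v \<Rightarrow> 'v"
    by (auto simp: additive_def)
  have a'': "additive (\<lambda>f. f x)" for x :: 'v and f :: "'v \<Rightarrow> 'v \<Rightarrow> 'v"
    by (auto simp: additive_def)
  have "fps_app (Post B) x = fps_conv (\<lambda>g h y. g (h y)) \<gamma> (fps_app B x)"
    unfolding fps_app_def by (rule fps_conv_assoc) (simp_all add: a a'' post_def)
  then show ?thesis
    unfolding fps_bil_def
    by (simp only:) (unfold fps_app_def, rule fps_conv_assoc, simp_all add: a a')
qed

lemma bil_Pre1:
  assumes "\<And>i. bihom s (fps_nth B i)"
  shows "fps_bil (Pre1 B) x y = fps_bil B (fps_app \<gamma> x) y"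
proof -
  have "fps_app (Pre1 B) x = fps_app B (fps_app \<gamma> x)"
    unfolding fps_app_def
    by (subst fps_conv_flip[of pre1], rule fps_conv_assoc)
      (auto simp: additive_def fun_eq_iff bihom_add[OF assms] bihom_zero[OF assms] pre1_def)
  then show ?thesis
    unfolding fps_bil_def by simp
qed

lemma bil_Pre2:
  assumes "\<And>i. bihom s (fps_nth B i)"
  shows "fps_bil (Pre2 B) x y = fps_bil B x (fps_app \<gamma> y)"
proof -
  \<comment> \<open>What \<open>pre2\<close> becomes once the first argument has been supplied, with
    the same convention at zero.\<close>
  let ?p = "\<lambda>g h. if g = 0 then 0 else (\<lambda>y. h (g y))"
  have h: "module_hom s s (fps_nth (fps_app B x) i)" for i
    by (rule fps_app_bihom[OF mod assms])
  have app: "fps_app F x = fps_conv (\<lambda>a f. f a) x F" for F :: "('v \<Rightarrow> 'v \<Rightarrow> 'v) fps"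
    unfolding fps_app_def by (rule fps_conv_flip)
  have "fps_app (Pre2 B) x = fps_conv ?p \<gamma> (fps_app B x)"
    unfolding app by (rule fps_conv_left_commute) (auto simp: additive_def fun_eq_iff pre2_def)
  moreover have "fps_app (fps_conv ?p \<gamma> H) y = fps_app H (fps_app \<gamma> y)"
    if "\<And>i. module_hom s s (fps_nth H i)" for H
    unfolding fps_app_def
    by (subst fps_conv_flip[of ?p], rule fps_conv_assoc)
      (auto simp: additive_def module_hom.add[OF that] module_hom.zero[OF that])
  ultimately show ?thesis
    unfolding fps_bil_def using h by simp
qed

lemma bihom_ops:
  assumes "\<And>i. bihom s (fps_nth B i)"
  shows "bihom s (fps_nth (Post B) i)" "bihom s (fps_nth (Pre1 B) i)" "bihom s (fps_nth (Pre2 B) i)"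
proof -
  interpret W: module "scale2 s" by (rule module_scale2[OF mod])
  have z: "bihom s 0" using W.subspace_0[OF subspace_bihom[OF mod]] by simp
  have sum: "(\<And>i. i \<in> I \<Longrightarrow> bihom s (f i)) \<Longrightarrow> bihom s (sum f I)" for I f
    using W.subspace_sum[OF subspace_bihom[OF mod], of I f] by simp
  have "bihom s (post (fps_nth \<gamma> i) (fps_nth B j))" "bihom s (pre1 (fps_nth \<gamma> i) (fps_nth B j))"
    "bihom s (pre2 (fps_nth \<gamma> i) (fps_nth B j))" for i j
    using module_hom_comp[OF bihom_homs(1)[OF assms[of j]] hom[of i]]
      module_hom_comp[OF bihom_homs(2)[OF assms[of j]] hom[of i]] bihom_homs[OF assms[of j]]
      module_hom_comp[OF hom[of i] bihom_homs(1)[OF assms[of j]]]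
      module_hom_comp[OF hom[of i] bihom_homs(2)[OF assms[of j]]]
    by (simp_all add: post_def pre1_def pre2_def z)
      (simp_all add: bihom_def)
  then show "bihom s (fps_nth (Post B) i)" "bihom s (fps_nth (Pre1 B) i)" "bihom s (fps_nth (Pre2 B) i)"
    by (auto simp: fps_conv_nth intro!: sum)
qed

lemma ad_eq:
  assumes "\<And>i. bihom s (fps_nth B i)"
  shows "ad B = ad' B"
proof (rule fps_ext)
  fix n
  have "lin_bracket g (fps_nth B i) = post g (fps_nth B i) - pre1 g (fps_nth B i) - pre2 g (fps_nth B i)" for g i
    by (auto simp: fun_eq_iff lin_bracket_def post_def pre1_def pre2_def bihom_zero[OF assms])
  then show "fps_nth (ad B) n = fps_nth (ad' B) n"
    by (simp add: fps_conv_nth sum_subtractf)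
qed

lemma bihom_ad':
  assumes "\<And>i. bihom s (fps_nth B i)"
  shows "bihom s (fps_nth (ad' B) i)"
proof -
  interpret W: module "scale2 s" by (rule module_scale2[OF mod])
  show ?thesis
    using W.subspace_diff[OF subspace_bihom[OF mod]] bihom_ops[OF assms] by simp
qed

lemma funpow_ad:
  assumes "\<And>i. bihom s (fps_nth B i)"
  shows "(ad ^^ j) B = (ad' ^^ j) B"
proof -
  \<comment> \<open>Bilinearity of the iterates is carried along because \<open>ad_eq\<close>
    requires it at every step.\<close>
  have "(ad ^^ j) B = (ad' ^^ j) B \<and> (\<forall>i. bihom s (fps_nth ((ad' ^^ j) B) i))"
  proof (induction j)
    case (Suc j)
    then have "bihom s (fps_nth (ad' ((ad' ^^ j) B)) i)" for i
      by (intro bihom_ad') blast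
    moreover have "ad ((ad' ^^ j) B) = ad' ((ad' ^^ j) B)"
      using Suc by (intro ad_eq) blast
    ultimately show ?case using Suc by (simp only: funpow.simps o_apply simp_thms)
  qed (use assms in simp)
  then show ?thesis ..
qed

lemma exp_conjugation:
  assumes "\<And>i. bihom s (fps_nth B i)"
  shows "bihom s (fps_nth (op_series (scale2 s) q (fps_exp 1) ad B) i)"
    and "fps_bil (op_series (scale2 s) q (fps_exp 1) ad B) (Exp x) (Exp y) = Exp (fps_bil B x y)"
proof -
  have eq: "op_series (scale2 s) q (fps_exp 1) ad B = ad'.ev (fps_exp 1) B"
    by (rule op_series_cong) (rule funpow_ad[OF assms])
  define C where "C = ad'.ev (fps_exp 1) B"
  define C2 where "C2 = Pre2.ev (fps_exp 1) C"
  have C: "bihom s (fps_nth C i)" for i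
    using ad'.ev_closed[OF subspace_bihom[OF mod], of B "fps_exp 1" i] bihom_ad' assms by (simp add: C_def)
  then show "bihom s (fps_nth (op_series (scale2 s) q (fps_exp 1) ad B) i)"
    by (simp add: eq C_def)
  have C2: "bihom s (fps_nth C2 i)" for i
    using Pre2.ev_closed[OF subspace_bihom[OF mod], of C "fps_exp 1" i] bihom_ops C by (simp add: C2_def)
  \<comment> \<open>The term by term hypothesis of \<open>op_series_transfer\<close>: iterating
    \<open>Pre2\<close> on \<open>C\<close> iterates \<open>fps_app \<gamma>\<close> in the second
    argument.\<close>
  have p2: "fps_bil ((Pre2 ^^ j) C) x y = fps_bil C x ((fps_app \<gamma> ^^ j) y) \<and>
      (\<forall>i. bihom s (fps_nth ((Pre2 ^^ j) C) i))" for j x y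
  proof (induction j arbitrary: y)
    case (Suc j)
    then show ?case
      by (simp add: bihom_ops bil_Pre2 funpow_swap1[of "fps_app \<gamma>"])
  qed (simp add: C)
  have p1: "fps_bil ((Pre1 ^^ j) C2) x y = fps_bil C2 ((fps_app \<gamma> ^^ j) x) y \<and>
      (\<forall>i. bihom s (fps_nth ((Pre1 ^^ j) C2) i))" for j x y
  proof (induction j arbitrary: x)
    case (Suc j)
    then show ?case
      by (simp add: bihom_ops bil_Pre1 funpow_swap1[of "fps_app \<gamma>"])
  qed (simp add: C2)
  \<comment> \<open>The arguments give up their exponentials one at a time: \<open>Pre2\<close>
    absorbs the one at \<open>y\<close>, \<open>Pre1\<close> the one at \<open>x\<close>. What
    results is the exponential of \<open>Post\<close>, that is, of the value.\<close>
  have "fps_bil C (Exp x) (Exp y) = fps_bil C2 (Exp x) y"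
    unfolding C2_def
    by (rule op_series_transfer[OF formal_op_app formal_op_Pre2 mod fps_bil_hom_right[OF mod C] fps_bil_hom[OF mod]])
      (simp add: p2)
  also have "\<dots> = fps_bil (Pre1.ev (fps_exp 1) C2) x y"
    by (rule op_series_transfer[OF formal_op_app formal_op_Pre1 mod fps_bil_hom_left[OF mod C2] fps_bil_hom[OF mod]])
      (simp add: p1)
  also have "\<dots> = fps_bil (Post.ev (fps_exp 1) B) x y"
    by (simp add: exp_Post C_def C2_def)
  also have "\<dots> = Exp (fps_bil B x y)"
    by (rule op_series_intertwine[OF formal_op_Post formal_op_app fps_bil_hom[OF mod]]) (rule bil_Post)
  finally show "fps_bil (op_series (scale2 s) q (fps_exp 1) ad B) (Exp x) (Exp y) = Exp (fps_bil B x y)"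
    by (simp add: eq C_def)
qed

text \<open>Reduces to \<open>exp_add_const\<close> for \<open>ad'\<close>; every series to which
  \<open>ad\<close> is applied here is bilinear, so \<open>ad\<close> may be exchanged for
  \<open>ad'\<close>.\<close>

lemma exp_ad_add_const:
  assumes "\<And>i. bihom s (fps_nth B i)" "\<And>i. bihom s (fps_nth M i)"
  shows "B + (op_series (scale2 s) q (fps_exp 1) ad M - Abs_fps (\<lambda>n. \<Sum>j=0..n.
      scale2 s (q (1 / fact (1 + j))) (fps_nth ((ad ^^ j) (- ad B)) n))) =
    op_series (scale2 s) q (fps_exp 1) ad (B + M)"
proof -
  interpret W: module "scale2 s" by (rule module_scale2[OF mod])
  have BM: "bihom s (fps_nth (B + M) i)" for i
    using W.subspace_add[OF subspace_bihom[OF mod]] assms by simp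
  have nB: "bihom s (fps_nth (- ad' B) i)" for i
    using W.subspace_neg[OF subspace_bihom[OF mod], of "fps_nth (ad' B) i"] bihom_ad'[OF assms(1)]
    by (simp only: fps_neg_nth mem_Collect_eq)
  show ?thesis
    unfolding ad_eq[OF assms(1)] funpow_ad[OF nB] op_series_cong[of ad _ ad', OF funpow_ad[OF BM]]
      op_series_cong[of ad _ ad', OF funpow_ad[OF assms(2)]]
    by (rule ad'.exp_add_const)
qed

end

section \<open>Hochschild cochains of low degree\<close>

text \<open>The curried side of the list encoding, on which composition and bilinearity are
  expressed directly.\<close>

definition cur1 :: "('v list \<Rightarrow> 'v) \<Rightarrow> 'v \<Rightarrow> 'v" where
  "cur1 f = (\<lambda>x. f [x])"

definition cur2 :: "('v list \<Rightarrow> 'v) \<Rightarrow> 'v \<Rightarrow> 'v \<Rightarrow> 'v" where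
  "cur2 f = (\<lambda>x y. f [x, y])"

definition cur3 :: "('v list \<Rightarrow> 'v) \<Rightarrow> 'v \<Rightarrow> 'v \<Rightarrow> 'v \<Rightarrow> 'v" where
  "cur3 f = (\<lambda>x y z. f [x, y, z])"

text \<open>The Gerstenhaber composition of two 2-cochains on curried maps. On the diagonal it is
  the associator.\<close>

definition assoc_defect ::
    "('v::ab_group_add \<Rightarrow> 'v \<Rightarrow> 'v) \<Rightarrow> ('v \<Rightarrow> 'v \<Rightarrow> 'v) \<Rightarrow> 'v \<Rightarrow> 'v \<Rightarrow> 'v \<Rightarrow> 'v" where
  "assoc_defect f g = (\<lambda>x y z. f (g x y) z - f x (g y z))"

lemma cur2_bracket_1_2: "cur2 (gerst_bracket 1 2 g f) = lin_bracket (cur1 g) (cur2 f)"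
  by (simp add: fun_eq_iff cur1_def cur2_def lin_bracket_def gerst_bracket_def gerst_comp_def signed_def
      numeral_2_eq_2)

text \<open>For arities 2 and 1 the sign exponent in the bracket is 0, so the bracket is
  antisymmetric.\<close>

lemma cur2_bracket_2_1: "cur2 (gerst_bracket 2 1 f g) = - lin_bracket (cur1 g) (cur2 f)"
  by (simp add: fun_eq_iff cur1_def cur2_def lin_bracket_def gerst_bracket_def gerst_comp_def signed_def
      numeral_2_eq_2)

text \<open>For arities 2 and 2 the sign exponent is 1, so the bracket is symmetric and its diagonal
  is twice the associator.\<close>

lemma cur3_bracket_2_2:
  "cur3 (gerst_bracket 2 2 f g) = assoc_defect (cur2 f) (cur2 g) + assoc_defect (cur2 g) (cur2 f)"
  by (simp add: fun_eq_iff cur3_def cur2_def assoc_defect_def gerst_bracket_def gerst_comp_def signed_def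
      numeral_2_eq_2)

lemma gerst_bracket_2_2_length: "length xs \<noteq> 3 \<Longrightarrow> gerst_bracket 2 2 f g xs = 0"
  by (simp add: gerst_bracket_def gerst_comp_def signed_def)

lemma gerst_bracket_1_2_length: "length xs \<noteq> 2 \<Longrightarrow> gerst_bracket 1 2 g f xs = 0"
  by (simp add: gerst_bracket_def gerst_comp_def signed_def)

lemma gerst_bracket_2_1_length: "length xs \<noteq> 2 \<Longrightarrow> gerst_bracket 2 1 g f xs = 0"
  by (simp add: gerst_bracket_def gerst_comp_def signed_def)

lemma cur1_hom: "multilinear s 1 f \<Longrightarrow> module_hom s s (cur1 f)"
  unfolding multilinear_def cur1_def by (auto dest!: spec[of _ "[0]"])

lemma cur2_bihom:
  assumes "multilinear s 2 f" shows "bihom s (cur2 f)"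
proof -
  have m: "module_hom s s (\<lambda>x. f (xs[i := x]))" if "length xs = 2" "i < 2" for xs i
    using assms that by (auto simp: multilinear_def)
  show ?thesis
    unfolding bihom_def cur2_def
  proof (intro conjI allI)
    show "module_hom s s (\<lambda>x. f [x, y])" for y
      using m[of "[0, y]" 0] by simp
    show "module_hom s s (\<lambda>y. f [x, y])" for x
      using m[of "[x, 0]" 1] by simp
  qed
qed

lemma multilinear_1I:
  assumes "module_hom s s g"
  shows "multilinear s 1 (\<lambda>xs. if length xs = 1 then g (hd xs) else 0)"
proof -
  have "module_hom s s (\<lambda>x. if length (xs[0 := x]) = 1 then g (hd (xs[0 := x])) else 0)"
    if "length xs = 1" for xs
    using that assms by (cases xs) auto
  then show ?thesis by (auto simp: multilinear_def)
qed

lemma multilinear_cochain2: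
  assumes "bihom s m" shows "multilinear s 2 (cochain2 m)"
  unfolding multilinear_def
proof (intro conjI allI impI)
  fix xs :: "'b list" and i :: nat assume "length xs = 2 \<and> i < 2"
  then obtain a b where "xs = [a, b]" "i = 0 \<or> i = 1"
    by (auto simp: numeral_2_eq_2 length_Suc_conv less_Suc_eq)
  then show "module_hom s s (\<lambda>x. cochain2 m (xs[i := x]))"
    using assms by (auto simp: cochain2_def bihom_def)
qed (simp add: cochain2_def)

lemma cur2_cochain2 [simp]: "cur2 (cochain2 m) = m"
  by (simp add: cur2_def cochain2_def)

lemma bilin_ext_eq_bil: "bilin_ext F = fps_bil (fps_map cur2 F)"
proof (intro ext fps_ext)
  fix x y n
  have "fps_nth (fps_bil (fps_map cur2 F) x y) n =
      (\<Sum>j=0..n. \<Sum>r=0..j. fps_nth F r [fps_nth x (j - r), fps_nth y (n - j)])"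
    by (simp add: fps_bil_def fps_app_def fps_conv_nth sum_fun_apply cur2_def)
  also have "\<dots> = (\<Sum>r=0..n. \<Sum>i=0..n - r. fps_nth F r [fps_nth x i, fps_nth y (n - r - i)])"
    by (rule fps_mult_assoc_lemma)
  finally show "fps_nth (bilin_ext F x y) n = fps_nth (fps_bil (fps_map cur2 F) x y) n"
    by (simp add: bilin_ext_def)
qed

section \<open>The gauge action as conjugation\<close>

text \<open>\<open>K\<close> and \<open>H\<close> read off the linear and bilinear maps of one
  component. \<open>H\<close> turns the bracket into \<open>lin_bracket\<close> and the differential
  into minus the bracket with \<open>m\<close>, so the gauge formula has the form treated in
  \<open>exp_ad_add_const\<close>. Applied once to tot and once to N.\<close>

lemma gauge_act_map:
  fixes g :: "('k::comm_ring_1, 'w::ab_group_add) dgla" and m :: 'w and K :: "'w \<Rightarrow> 'v \<Rightarrow> 'v::ab_group_add"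
  assumes "formal_derivation s q (fps_map K \<gamma>)"
    and H: "additive H" "\<And>c v. H (scal g c v) = (\<lambda>x y. s c (H v x y))"
      "\<And>u v. H (brak g 0 1 u v) = lin_bracket (K u) (H v)"
      "\<And>u. H (diff g 0 u) = - lin_bracket (K u) (H m)"
    and bihom: "\<And>i. bihom s (H (fps_nth \<xi> i))" "bihom s (H m)"
  shows "fps_map H (fps_const m + gauge_act q g \<gamma> \<xi>) =
    op_series (\<lambda>c f x y. s c (f x y)) q (fps_exp 1) (fps_conv lin_bracket (fps_map K \<gamma>))
      (fps_map H (fps_const m + \<xi>))"
proof -
  interpret formal_derivation s q "fps_map K \<gamma>" by fact
  interpret H: additive H by fact
  have H0: "H 0 = 0" by (rule H.zero)
  have map_add: "fps_map H (x + y) = fps_map H x + fps_map H y" for x y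
    by (rule fps_ext) (simp add: H.add)
  have map_const: "fps_map H (fps_const a) = fps_const (H a)" for a
    by (rule fps_ext) (simp add: H0)
  have step: "fps_map H (fps_conv (brak g 0 1) \<gamma> x) = ad (fps_map H x)" for x
    by (rule fps_ext) (simp add: fps_conv_nth H.sum H(3))
  have pow: "fps_map H ((fps_conv (brak g 0 1) \<gamma> ^^ j) x) = (ad ^^ j) (fps_map H x)" for j x
    by (induction j) (simp_all add: step)
  have pow_nth: "H (fps_nth ((fps_conv (brak g 0 1) \<gamma> ^^ j) x) n) = fps_nth ((ad ^^ j) (fps_map H x)) n" for j x n
    by (simp only: pow[symmetric] fps_map_nth)
  \<comment> \<open>On a constant series \<open>ad\<close> is computed coefficientwise in \<gamma>,
    just like the differential of \<gamma>.\<close>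
  have "fps_conv lin_bracket (fps_map K \<gamma>) (fps_const (H m)) = fps_map (\<lambda>f. lin_bracket f (H m)) (fps_map K \<gamma>)"
    using zero by (intro fps_conv_const_right) (simp add: lin_bracket_def fun_eq_iff)
  then have d: "fps_map H (fps_map (diff g 0) \<gamma>) = - ad (fps_const (H m))"
    by (simp only:) (rule fps_ext, simp add: H(4))
  have "fps_map H (fps_const m + gauge_act q g \<gamma> \<xi>) = fps_const (H m) +
     (op_series (\<lambda>c f x y. s c (f x y)) q (fps_exp 1) ad (fps_map H \<xi>) - Abs_fps (\<lambda>n. \<Sum>j=0..n.
      (\<lambda>x y. s (q (1 / fact (1 + j))) (fps_nth ((ad ^^ j) (- ad (fps_const (H m)))) n x y))))"
    unfolding map_add map_const
    by (rule fps_ext) (simp add: gauge_act_def Let_def H.diff H.sum H(2) pow_nth d op_series_def)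
  also have "\<dots> = op_series (\<lambda>c f x y. s c (f x y)) q (fps_exp 1) ad (fps_const (H m) + fps_map H \<xi>)"
    using bihom module.subspace_0[OF module_scale2 subspace_bihom, OF mod mod]
    by (intro exp_ad_add_const) auto
  finally show ?thesis by (simp only: map_add map_const)
qed

section \<open>The Maurer--Cartan equation as associativity\<close>

text \<open>On constants the associator of the product has the coefficients of
  \<open>fps_conv assoc_defect B B\<close>; both sides of associativity are linear in each argument,
  so constants suffice.\<close>

lemma fps_bil_assoc_iff:
  fixes s :: "'k::comm_ring_1 \<Rightarrow> 'a::ab_group_add \<Rightarrow> 'a"
  assumes mod: "module s" and B: "\<And>i. bihom s (fps_nth B i)"
  shows "(\<forall>x y z. fps_bil B (fps_bil B x y) z = fps_bil B x (fps_bil B y z)) \<longleftrightarrow>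
    fps_conv assoc_defect B B = 0"
proof -
  note bh = fps_bil_bihom[OF assms]
  note left = bihom_homs(1)[OF bh] and right = bihom_homs(2)[OF bh]
  have cl: "fps_nth (fps_bil B u (fps_const z)) n = (\<Sum>i=0..n. fps_nth B i (fps_nth u (n - i)) z)" for u z n
    unfolding fps_bil_def
    by (subst fps_app_const[OF mod mod], rule fps_app_bihom[OF assms])
      (simp add: fps_app_def fps_conv_nth sum_fun_apply)
  have cr: "fps_nth (fps_bil B (fps_const x) u) n = (\<Sum>i=0..n. fps_nth B i x (fps_nth u (n - i)))" for u x n
  proof -
    have "fps_nth (fps_app F u) n = (\<Sum>i=0..n. fps_nth F i (fps_nth u (n - i)))" for F :: "('a \<Rightarrow> 'a) fps"
      by (simp add: fps_app_def fps_conv_nth)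
    then show ?thesis
      by (simp add: fps_bil_def fps_app_const[OF mod module_pointwise[OF mod] bihom_scale1[OF mod B]])
  qed
  have c: "fps_nth (fps_bil B (fps_bil B (fps_const x) (fps_const y)) (fps_const z)) n -
      fps_nth (fps_bil B (fps_const x) (fps_bil B (fps_const y) (fps_const z))) n =
      fps_nth (fps_conv assoc_defect B B) n x y z" for x y z n
    by (simp add: cl[of "fps_bil B (fps_const x) (fps_const y)"]
        cr[of x "fps_bil B (fps_const y) (fps_const z)"] fps_bil_const[OF assms] fps_conv_nth sum_fun_apply assoc_defect_def sum_subtractf)
  show ?thesis
  proof
    assume "\<forall>x y z. fps_bil B (fps_bil B x y) z = fps_bil B x (fps_bil B y z)"
    then show "fps_conv assoc_defect B B = 0"
      using c by (intro fps_ext) (simp add: fun_eq_iff)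
  next
    assume 0: "fps_conv assoc_defect B B = 0"
    have 1: "fps_bil B (fps_bil B (fps_const x) (fps_const y)) (fps_const z) =
        fps_bil B (fps_const x) (fps_bil B (fps_const y) (fps_const z))" for x y z
      using c[of x y z] by (intro fps_ext) (simp add: 0)
    \<comment> \<open>The arguments are freed from being constant one by one: \<open>z\<close>, then
      \<open>y\<close>, then \<open>x\<close>.\<close>
    have 2: "fps_bil B (fps_bil B (fps_const x) (fps_const y)) z =
        fps_bil B (fps_const x) (fps_bil B (fps_const y) z)" for x y z
      by (rule series_hom_eqI[OF mod mod right module_hom_comp[OF right right]]) (rule 1)
    have 3: "fps_bil B (fps_bil B (fps_const x) y) z = fps_bil B (fps_const x) (fps_bil B y z)" for x y z
      by (rule series_hom_eqI[OF mod mod module_hom_comp[OF right left] module_hom_comp[OF left right]]) (rule 2)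
    have "fps_bil B (fps_bil B x y) z = fps_bil B x (fps_bil B y z)" for x y z
      by (rule series_hom_eqI[OF mod mod module_hom_comp[OF left left] left]) (rule 3)
    then show "\<forall>x y z. fps_bil B (fps_bil B x y) z = fps_bil B x (fps_bil B y z)" by blast
  qed
qed

text \<open>Expanding the Gerstenhaber square of \<open>m + \<xi>\<close> gives the square of
  \<open>m\<close>, which is 0, the mixed terms, which are the differential of \<xi>, and the square
  of \<xi>, which is half the bracket.\<close>

lemma maurer_cartan_map:
  fixes g :: "('k::comm_ring_1, 'w::ab_group_add) dgla" and m :: 'w and H :: "'w \<Rightarrow> 'v \<Rightarrow> 'v \<Rightarrow> 'v::ab_group_add"
  assumes mod: "module s" and rat: "rat_embedding q"
    and H: "additive H" "additive H3" "\<And>c v. H3 (scal g c v) = (\<lambda>x y z. s c (H3 v x y z))"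
      "\<And>u v. H3 (brak g 1 1 u v) = assoc_defect (H u) (H v) + assoc_defect (H v) (H u)"
      "\<And>u. H3 (diff g 1 u) = assoc_defect (H m) (H u) + assoc_defect (H u) (H m)"
    and bihom: "\<And>i. bihom s (H (fps_nth \<xi> i))" "bihom s (H m)" and assoc: "assoc_defect (H m) (H m) = 0"
  shows "fps_map H3 (fps_map (diff g 1) \<xi> + fps_map (scal g (q (1/2))) (fps_conv (brak g 1 1) \<xi> \<xi>)) =
    fps_conv assoc_defect (fps_map H (fps_const m + \<xi>)) (fps_map H (fps_const m + \<xi>))"
proof -
  interpret s: module s by fact
  interpret H: additive H by fact
  interpret H3: additive H3 by fact
  define M where "M = fps_map H \<xi>"
  define C where "C = fps_const (H m)"
  have M: "bihom s (fps_nth M i)" and C: "bihom s (fps_nth C i)" for i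
    using module.subspace_0[OF module_scale2 subspace_bihom, OF mod mod] bihom by (auto simp: M_def C_def)
  have split: "fps_map H (fps_const m + \<xi>) = C + M"
    by (rule fps_ext) (simp add: H.add H.zero C_def M_def)
  have al: "additive (\<lambda>u. assoc_defect u v)" for v :: "'v \<Rightarrow> 'v \<Rightarrow> 'v"
    by (auto simp: additive_def fun_eq_iff assoc_defect_def)
  have ar: "additive (assoc_defect f)" if "bihom s f" for f :: "'v \<Rightarrow> 'v \<Rightarrow> 'v"
    by (auto simp: additive_def fun_eq_iff assoc_defect_def bihom_add[OF that])
  have a0: "assoc_defect 0 v = 0" for v :: "'v \<Rightarrow> 'v \<Rightarrow> 'v"
    by (auto simp: fun_eq_iff assoc_defect_def)
  have "fps_conv assoc_defect (C + M) (C + M) =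
      fps_conv assoc_defect C C + fps_conv assoc_defect M C + (fps_conv assoc_defect C M + fps_conv assoc_defect M M)"
    by (simp add: fps_conv_add_left[OF al] fps_conv_add_right[OF ar] M C algebra_simps)
  also have "fps_conv assoc_defect C C = 0"
    unfolding C_def by (subst fps_conv_const_left)
      (auto intro!: fps_ext simp: assoc a0 additive.zero[OF ar] bihom)
  also have "fps_conv assoc_defect C M = fps_map (assoc_defect (H m)) M"
    unfolding C_def by (rule fps_conv_const_left) (rule a0)
  also have "fps_conv assoc_defect M C = fps_map (\<lambda>u. assoc_defect u (H m)) M"
    unfolding C_def by (rule fps_conv_const_right) (rule additive.zero[OF ar[OF M]])
  finally have R: "fps_conv assoc_defect (C + M) (C + M) =
      fps_map (\<lambda>u. assoc_defect (H m) u + assoc_defect u (H m)) M + fps_conv assoc_defect M M"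
    by (simp, intro fps_ext) (simp add: algebra_simps)
  have sq: "fps_map H3 (fps_conv (brak g 1 1) \<xi> \<xi>) = fps_conv assoc_defect M M + fps_conv assoc_defect M M"
  proof -
    have "fps_conv (\<lambda>u v. assoc_defect v u) M M = fps_conv assoc_defect M M"
      by (rule fps_conv_flip[symmetric])
    moreover have "fps_map H3 (fps_conv (brak g 1 1) \<xi> \<xi>) =
        fps_conv assoc_defect M M + fps_conv (\<lambda>u v. assoc_defect v u) M M"
      by (rule fps_ext) (simp add: fps_conv_nth H3.sum H M_def sum.distrib)
    ultimately show ?thesis by simp
  qed
  \<comment> \<open>Cancels the factor 2 that \<open>sq\<close> produces, using \<open>1/2\<close>
    in \<open>k\<close>.\<close>
  have half: "s (q (1/2)) (v + v) = v" for v
  proof -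
    have "q (1/2) + q (1/2) = 1"
      by (simp add: rat_embedding_simps(2)[OF rat] flip: rat_embedding_simps(3)[OF rat])
    then show ?thesis
      by (simp only: s.scale_right_distrib s.scale_left_distrib[symmetric] s.scale_one)
  qed
  have "H3 (fps_nth (fps_conv (brak g 1 1) \<xi> \<xi>) n) =
      fps_nth (fps_conv assoc_defect M M) n + fps_nth (fps_conv assoc_defect M M) n" for n
    using arg_cong[OF sq, of "\<lambda>f. fps_nth f n"] by simp
  then show ?thesis
    unfolding split R
    by (intro fps_ext) (simp add: H3.add H half M_def fun_eq_iff)
qed

section \<open>Formal deformations of a coisotropic algebra\<close>

lemma fps_bil_nth_0: "fps_nth (fps_bil B x y) 0 = fps_nth B 0 (fps_nth x 0) (fps_nth y 0)"
  by (simp add: fps_bil_def fps_app_def fps_conv_nth)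

text \<open>\<open>L - id\<close> kills the constant coefficient, so the geometric series supplies
  the inverse of \<open>L\<close>.\<close>

lemma unipotent_bij:
  fixes s :: "'k::comm_ring_1 \<Rightarrow> 'v::ab_group_add \<Rightarrow> 'v" and q :: "rat \<Rightarrow> 'k"
  assumes "module s" "rat_embedding q" "module_hom (fps_conv s) (fps_conv s) L"
    and "\<And>x. fps_nth (L x) 0 = fps_nth x 0"
  shows "bij L"
proof -
  interpret formal_op s q "\<lambda>x. L x - x"
    by (simp add: formal_op_def assms module_hom_minus module_hom_ident module_series)
  show ?thesis
    by (rule o_bij[of "ev (inverse (1 + fps_X))"])
      (use one_plus_inverse in \<open>simp_all add: fun_eq_iff\<close>)
qed

text \<open>The unit of a deformation of a unital product is the preimage of the old unit \<open>e\<^sub>0\<close> under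
  multiplication by \<open>e\<^sub>0\<close>.\<close>

lemma deformed_unit:
  fixes s :: "'k::comm_ring_1 \<Rightarrow> 'v::ab_group_add \<Rightarrow> 'v" and q :: "rat \<Rightarrow> 'k"
  assumes mod: "module s" and "rat_embedding q" and B: "\<And>i. bihom s (fps_nth B i)"
    and assoc: "\<And>x y z. fps_bil B (fps_bil B x y) z = fps_bil B x (fps_bil B y z)"
    and unit: "\<And>x. fps_nth B 0 e0 x = x" "\<And>x. fps_nth B 0 x e0 = x"
  shows "inj (fps_bil B (fps_const e0))"
    and "\<exists>e. fps_bil B (fps_const e0) e = fps_const e0 \<and> (\<forall>x. fps_bil B e x = x \<and> fps_bil B x e = x)"
proof -
  let ?L = "fps_bil B (fps_const e0)" and ?R = "\<lambda>x. fps_bil B x (fps_const e0)"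
  have L: "bij ?L"
    by (rule unipotent_bij[OF mod assms(2) fps_bil_hom_right[OF mod B]]) (simp add: fps_bil_nth_0 unit)
  have R: "bij ?R"
    by (rule unipotent_bij[OF mod assms(2) fps_bil_hom_left[OF mod B]]) (simp add: fps_bil_nth_0 unit)
  show "inj ?L" by (rule bij_is_inj[OF L])
  obtain e e' where e: "?L e = fps_const e0" and e': "?R e' = fps_const e0"
    using bij_is_surj[OF L] bij_is_surj[OF R] by (metis surjD)
  \<comment> \<open>In multiplicative notation \<open>e0 (e x) = (e0 e) x = e0 x\<close>, and
    \<open>e0\<close> cancels on the left.\<close>
  have l: "fps_bil B e x = x" for x
    by (rule injD[OF bij_is_inj[OF L]]) (simp add: e flip: assoc)
  have r: "fps_bil B x e' = x" for x
    by (rule injD[OF bij_is_inj[OF R]]) (simp add: e' assoc)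
  have "e' = e" using l[of e'] r[of e] by simp
  then show "\<exists>e. fps_bil B (fps_const e0) e = fps_const e0 \<and> (\<forall>x. fps_bil B e x = x \<and> fps_bil B x e = x)"
    using e l r by blast
qed

lemma series_module_simps [simp]:
  "scaleT (series_module E) = fps_conv (scaleT E)" "scaleN (series_module E) = fps_conv (scaleN E)"
  "incl (series_module E) = fps_map (incl E)" "sub0 (series_module E) = {x. \<forall>n. fps_nth x n \<in> sub0 E}"
  by (simp_all add: series_module_def)

lemma series_algebra_simps [simp]:
  "scaleT (series_algebra E \<mu>) = fps_conv (scaleT E)" "scaleN (series_algebra E \<mu>) = fps_conv (scaleN E)"
  "incl (series_algebra E \<mu>) = fps_map (incl E)" "sub0 (series_algebra E \<mu>) = {x. \<forall>n. fps_nth x n \<in> sub0 E}"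
  "mulT (series_algebra E \<mu>) = fst \<mu>" "mulN (series_algebra E \<mu>) = snd \<mu>"
  by (simp_all add: series_algebra_def series_module_def coiso_module.defs coiso_algebra.defs)

lemma subspace_series:
  assumes "module s" "module.subspace s U"
  shows "module.subspace (fps_conv s) {x. \<forall>n. fps_nth x n \<in> U}"
proof -
  interpret m: module s by fact
  interpret M: module "fps_conv s" by (rule module_series) fact
  show ?thesis
    unfolding M.subspace_def fps_conv_nth using assms(2)
    by (auto simp: fps_conv_nth intro!: m.subspace_add m.subspace_0 m.subspace_sum m.subspace_scale)
qed

lemma coisotropic_series_module:
  "coisotropic_module E \<Longrightarrow> coisotropic_module (series_module E)"
  by (simp add: coisotropic_module_def module_series fps_map_hom subspace_series)

lemma fps_map_comp: "fps_map f (fps_map g x) = fps_map (\<lambda>v. f (g v)) x"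
  by (rule fps_ext) simp

abbreviation "curT \<equiv> \<lambda>f. cur2 (fst f)"
abbreviation "curN \<equiv> \<lambda>f. cur2 (snd f)"

lemma product_of_eq: "product_of F = (fps_bil (fps_map curT F), fps_bil (fps_map curN F))"
  by (simp add: product_of_def bilin_ext_eq_bil fps_map_comp)

lemma coisotropic_morphism_comp:
  assumes "coisotropic_morphism E F S" "coisotropic_morphism F G T"
  shows "coisotropic_morphism E G (fst T \<circ> fst S, snd T \<circ> snd S)"
  using assms by (auto simp: coisotropic_morphism_def o_def image_subset_iff intro: module_hom_comp)

lemma coisotropic_morphism_id: "coisotropic_module E \<Longrightarrow> coisotropic_morphism E E (id, id)"
  by (simp add: coisotropic_morphism_def coisotropic_module_def id_def module_hom_ident)

locale coiso_deformation =
  fixes q :: "rat \<Rightarrow> 'k::comm_ring_1"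
    and A :: "('k, 'a::ab_group_add, 'n::ab_group_add) coiso_algebra"
  assumes rat: "rat_embedding q" and alg: "coisotropic_algebra A"
begin

lemma module_A: "coisotropic_module A"
  using alg by (simp add: coisotropic_algebra_def)

lemma modT: "module (scaleT A)" and modN: "module (scaleN A)"
  and incl_hom: "module_hom (scaleN A) (scaleT A) (incl A)"
  and subspace0: "module.subspace (scaleN A) (sub0 A)"
  using module_A by (auto simp: coisotropic_module_def)

sublocale mT: module "scaleT A" by (rule modT)
sublocale mN: module "scaleN A" by (rule modN)
sublocale incl: module_hom "scaleN A" "scaleT A" "incl A" by (rule incl_hom)

lemma bihom_mul: "bihom (scaleT A) (mulT A)" "bihom (scaleN A) (mulN A)"
  and mul_assoc: "mulT A (mulT A x y) z = mulT A x (mulT A y z)"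
    "mulN A (mulN A x' y') z' = mulN A x' (mulN A y' z')"
  using alg by (auto simp: coisotropic_algebra_def unital_algebra_def bihom_def)

lemma units:
  "\<exists>e. (\<forall>x. mulN A e x = x \<and> mulN A x e = x) \<and>
    (\<forall>x. mulT A (incl A e) x = x \<and> mulT A x (incl A e) = x)"
  using alg by (auto simp: coisotropic_algebra_def unital_algebra_def)

lemma cochains2:
  assumes "f \<in> cochainsN A 2"
  shows "bihom (scaleT A) (curT f)" "bihom (scaleN A) (curN f)"
    "incl A (curN f x y) = curT f (incl A x) (incl A y)"
    "x \<in> sub0 A \<or> y \<in> sub0 A \<Longrightarrow> curN f x y \<in> sub0 A"
    "length xs \<noteq> 2 \<Longrightarrow> fst f xs = 0" "length ys \<noteq> 2 \<Longrightarrow> snd f ys = 0"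
proof -
  obtain fT fN where f: "f = (fT, fN)" by (cases f)
  have m: "multilinear (scaleT A) 2 fT" "multilinear (scaleN A) 2 fN"
    and i: "\<And>xs. length xs = 2 \<Longrightarrow> incl A (fN xs) = fT (map (incl A) xs)"
    and z: "\<And>xs. length xs = 2 \<and> (\<exists>x \<in> set xs. x \<in> sub0 A) \<Longrightarrow> fN xs \<in> sub0 A"
    using assms by (auto simp: cochainsN_def f)
  show "bihom (scaleT A) (curT f)" "bihom (scaleN A) (curN f)"
    using m by (simp_all add: f cur2_bihom)
  show "incl A (curN f x y) = curT f (incl A x) (incl A y)"
    using i[of "[x, y]"] by (simp add: f cur2_def)
  show "x \<in> sub0 A \<or> y \<in> sub0 A \<Longrightarrow> curN f x y \<in> sub0 A"
    using z[of "[x, y]"] by (auto simp: f cur2_def)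
  show "length xs \<noteq> 2 \<Longrightarrow> fst f xs = 0" "length ys \<noteq> 2 \<Longrightarrow> snd f ys = 0"
    using m by (auto simp: f multilinear_def)
qed

lemma cochain_eqI:
  assumes "curT f = curT g" "curN f = curN g"
    and "\<And>xs. length xs \<noteq> 2 \<Longrightarrow> fst f xs = fst g xs" "\<And>xs. length xs \<noteq> 2 \<Longrightarrow> snd f xs = snd g xs"
  shows "f = g"
proof -
  have eq: "h = k" if "cur2 h = cur2 k" "\<And>xs. length xs \<noteq> 2 \<Longrightarrow> h xs = k xs" for h k :: "'z list \<Rightarrow> 'z"
  proof
    fix xs :: "'z list"
    show "h xs = k xs"
    proof (cases "length xs = 2")
      case True
      then obtain a b where "xs = [a, b]" by (auto simp: numeral_2_eq_2 length_Suc_conv)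
      then show ?thesis using fun_cong[OF fun_cong[OF that(1)], of a b] by (simp add: cur2_def)
    qed (rule that(2))
  qed
  show ?thesis using assms by (intro prod_eqI eq)
qed

lemma cochain2_fields [simp]: "curT (mu0 A) = mulT A" "curN (mu0 A) = mulN A"
  by (simp_all add: mu0_def)

lemma mu0_cochain: "mu0 A \<in> cochainsN A 2"
proof -
  have 2: "\<exists>x y. xs = [x, y]" if "length xs = 2" for xs :: "'n list"
    using that by (auto simp: numeral_2_eq_2 length_Suc_conv)
  have "incl A (mulN A x y) = mulT A (incl A x) (incl A y)"
    "x \<in> sub0 A \<or> y \<in> sub0 A \<Longrightarrow> mulN A x y \<in> sub0 A" for x y
    using alg by (auto simp: coisotropic_algebra_def)
  then show ?thesis
    by (auto simp: mu0_def cochainsN_def multilinear_cochain2 bihom_mul cochain2_def dest!: 2)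
qed

lemma zero_cochain: "0 \<in> cochainsN A 2"
  by (auto simp: cochainsN_def zero_prod_def multilinear_def mN.subspace_0[OF subspace0]
      intro!: module_homI modT modN)

definition cochain_series :: "(('a list \<Rightarrow> 'a) \<times> ('n list \<Rightarrow> 'n)) fps \<Rightarrow> bool" where
  "cochain_series F \<longleftrightarrow> (\<forall>r. fps_nth F r \<in> cochainsN A 2)"

definition assoc_series :: "(('a list \<Rightarrow> 'a) \<times> ('n list \<Rightarrow> 'n)) fps \<Rightarrow> bool" where
  "assoc_series F \<longleftrightarrow>
    (\<forall>x y z. fps_bil (fps_map curT F) (fps_bil (fps_map curT F) x y) z =
      fps_bil (fps_map curT F) x (fps_bil (fps_map curT F) y z)) \<and>
    (\<forall>x y z. fps_bil (fps_map curN F) (fps_bil (fps_map curN F) x y) z =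
      fps_bil (fps_map curN F) x (fps_bil (fps_map curN F) y z))"

lemma fps_bil_nth: "fps_nth (fps_bil B x y) n = (\<Sum>j=0..n. \<Sum>r=0..j. fps_nth B r (fps_nth x (j - r)) (fps_nth y (n - j)))"
  by (simp add: fps_bil_def fps_app_def fps_conv_nth sum_fun_apply)

lemma incl_bil:
  assumes "cochain_series F"
  shows "fps_map (incl A) (fps_bil (fps_map curN F) x y) =
    fps_bil (fps_map curT F) (fps_map (incl A) x) (fps_map (incl A) y)"
  using assms by (intro fps_ext) (simp add: fps_bil_nth incl.sum cochains2 cochain_series_def)

lemma sub0_bil:
  assumes "cochain_series F" "(\<forall>n. fps_nth x n \<in> sub0 A) \<or> (\<forall>n. fps_nth y n \<in> sub0 A)"
  shows "fps_nth (fps_bil (fps_map curN F) x y) n \<in> sub0 A"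
  unfolding fps_bil_nth fps_map_nth
  by (intro mN.subspace_sum subspace0 cochains2) (use assms in \<open>auto simp: cochain_series_def\<close>)

lemma bihom_series:
  assumes "cochain_series F"
  shows "bihom (scaleT A) (fps_nth (fps_map curT F) i)" "bihom (scaleN A) (fps_nth (fps_map curN F) i)"
  using assms by (auto simp: cochain_series_def cochains2)

text \<open>Bilinearity, compatibility with \<open>incl\<close> and the ideal property come from the
  cochain conditions, and the units from \<open>deformed_unit\<close>; associativity is what
  remains.\<close>

lemma coisotropic_algebra_iff:
  assumes F: "cochain_series F" "fps_nth F 0 = mu0 A"
  shows "coisotropic_algebra (series_algebra A (product_of F)) \<longleftrightarrow> assoc_series F"
proof
  assume "coisotropic_algebra (series_algebra A (product_of F))"
  then show "assoc_series F"
    by (auto simp: coisotropic_algebra_def unital_algebra_def assoc_series_def product_of_eq)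
next
  assume assoc: "assoc_series F"
  let ?T = "fps_bil (fps_map curT F)" and ?N = "fps_bil (fps_map curN F)"
  note bT = bihom_series(1)[OF F(1)] and bN = bihom_series(2)[OF F(1)]
  have aT: "?T (?T x y) z = ?T x (?T y z)" for x y z using assoc by (simp add: assoc_series_def)
  have aN: "?N (?N x y) z = ?N x (?N y z)" for x y z using assoc by (simp add: assoc_series_def)
  obtain e where e: "\<And>x. mulN A e x = x" "\<And>x. mulN A x e = x"
    "\<And>x. mulT A (incl A e) x = x" "\<And>x. mulT A x (incl A e) = x" using units by blast
  have "\<exists>e'. ?N (fps_const e) e' = fps_const e \<and> (\<forall>x. ?N e' x = x \<and> ?N x e' = x)"
    by (rule deformed_unit(2)[OF modN rat bN aN]) (simp_all add: F e)
  then obtain eN where eN: "?N (fps_const e) eN = fps_const e" "\<forall>x. ?N eN x = x \<and> ?N x eN = x" by blast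
  let ?eT = "fps_const (incl A e)"
  have "\<exists>e'. ?T ?eT e' = ?eT \<and> (\<forall>x. ?T e' x = x \<and> ?T x e' = x)"
    by (rule deformed_unit(2)[OF modT rat bT aT]) (simp_all add: F e)
  then obtain eT where eT: "?T ?eT eT = ?eT" "\<forall>x. ?T eT x = x \<and> ?T x eT = x" by blast
  have i: "fps_map (incl A) (fps_const e) = ?eT"
    by (rule fps_ext) simp
  \<comment> \<open>The image of the N-unit and the tot-unit both solve \<open>?eT * e = ?eT\<close>
    in the tot-component; injectivity makes them equal.\<close>
  have "inj (?T ?eT)"
    by (rule deformed_unit(1)[OF modT rat bT aT]) (simp_all add: F e)
  moreover have "?T ?eT (fps_map (incl A) eN) = ?T ?eT eT"
    using arg_cong[OF eN(1), of "fps_map (incl A)"] by (simp add: incl_bil[OF F(1)] i eT)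
  ultimately have "fps_map (incl A) eN = eT" by (rule injD)
  moreover have "unital_algebra (fps_conv (scaleT A)) ?T eT"
    using bihom_homs[OF fps_bil_bihom[OF modT bT]] aT eT
    by (simp add: unital_algebra_def module_series modT)
  moreover have "unital_algebra (fps_conv (scaleN A)) ?N eN"
    using bihom_homs[OF fps_bil_bihom[OF modN bN]] aN eN
    by (simp add: unital_algebra_def module_series modN)
  moreover have "coisotropic_module (series_algebra A (product_of F))"
    using coisotropic_series_module[OF module_A] by (simp add: coisotropic_module_def)
  ultimately show "coisotropic_algebra (series_algebra A (product_of F))"
    using sub0_bil[OF F(1)]
    by (auto simp: coisotropic_algebra_def product_of_eq incl_bil[OF F(1)])
qed

section \<open>The Maurer-Cartan equation in the Hochschild DGLA\<close>

lemma hochschildN_simps [simp]: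
  "homog (hochschildN A) = graded (cochainsN A)"
  "scal (hochschildN A) = (\<lambda>c f. (\<lambda>xs. scaleT A c (fst f xs), \<lambda>xs. scaleN A c (snd f xs)))"
  "brak (hochschildN A) = (\<lambda>p q. gerst_bracketN (arity p) (arity q))"
  "diff (hochschildN A) = (\<lambda>p. gerst_bracketN 2 (arity p) (mu0 A))"
  by (simp_all add: hochschildN_def split_def)

lemma arity_simps: "arity 0 = 1" "arity 1 = 2"
  by (simp_all add: arity_def)

lemma lambda_comp_1: "lambda_comp (hochschildN A) 1 = {M. fps_nth M 0 = 0 \<and> cochain_series M}"
  by (simp add: lambda_comp_def graded_def arity_simps cochain_series_def)

lemma lambda_comp_0: "lambda_comp (hochschildN A) 0 = {\<gamma>. fps_nth \<gamma> 0 = 0 \<and> (\<forall>n. fps_nth \<gamma> n \<in> cochainsN A 1)}"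
  by (simp add: lambda_comp_def graded_def arity_simps)

lemma cur3_eq_0_iff:
  assumes "\<And>xs. length xs \<noteq> 3 \<Longrightarrow> h xs = 0"
  shows "h = 0 \<longleftrightarrow> cur3 h = 0"
proof
  assume cur: "cur3 h = 0"
  show "h = 0"
  proof
    fix xs
    show "h xs = 0 xs"
    proof (cases "length xs = 3")
      case True
      then obtain a b c where "xs = [a, b, c]" by (auto simp: numeral_3_eq_3 length_Suc_conv)
      then show ?thesis using fun_cong[OF fun_cong[OF fun_cong[OF cur]], of a b c] by (simp add: cur3_def)
    qed (simp add: assms)
  qed
qed (simp add: cur3_def zero_fun_def)

lemma additive_cur: "additive curT" "additive curN" "additive (\<lambda>f. cur3 (fst f))" "additive (\<lambda>f. cur3 (snd f))"
  by (auto simp: additive_def cur2_def cur3_def fun_eq_iff)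

lemma maurer_cartan_iff:
  "M \<in> maurer_cartan q (hochschildN A) \<longleftrightarrow>
    fps_nth M 0 = 0 \<and> cochain_series M \<and> assoc_series (fps_const (mu0 A) + M)"
proof (cases "fps_nth M 0 = 0 \<and> cochain_series M")
  case True
  let ?F = "fps_const (mu0 A) + M"
  let ?E = "fps_map (diff (hochschildN A) 1) M +
    fps_map (scal (hochschildN A) (q (1/2))) (fps_conv (brak (hochschildN A) 1 1) M M)"
  have M: "fps_nth M i \<in> cochainsN A 2" for i using True by (simp add: cochain_series_def)
  have bF: "bihom (scaleT A) (fps_nth (fps_map curT ?F) i)" "bihom (scaleN A) (fps_nth (fps_map curN ?F) i)" for i
  proof -
    have "fps_nth ?F i \<in> cochainsN A 2"
      using True M mu0_cochain by (cases i) auto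
    then show "bihom (scaleT A) (fps_nth (fps_map curT ?F) i)" "bihom (scaleN A) (fps_nth (fps_map curN ?F) i)"
      by (simp_all only: cochains2 fps_map_nth)
  qed
  \<comment> \<open>Off length 3 the equation holds trivially, so it can be tested after passing to
    curried maps.\<close>
  have zT: "fst (fps_nth ?E n) xs = 0" if "length xs \<noteq> 3" for n xs
    using that by (simp add: gerst_bracketN_def arity_simps gerst_bracket_2_2_length fps_conv_nth
      fst_sum sum_fun_apply)
  have zN: "snd (fps_nth ?E n) xs = 0" if "length xs \<noteq> 3" for n xs
    using that by (simp add: gerst_bracketN_def arity_simps gerst_bracket_2_2_length fps_conv_nth
      snd_sum sum_fun_apply)
  have sT: "cur3 (\<lambda>xs. scaleT A c (h xs)) = (\<lambda>x y z. scaleT A c (cur3 h x y z))" for c h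
    by (simp add: cur3_def)
  have sN: "cur3 (\<lambda>xs. scaleN A c (h xs)) = (\<lambda>x y z. scaleN A c (cur3 h x y z))" for c h
    by (simp add: cur3_def)
  have aT: "assoc_defect (mulT A) (mulT A) = 0" and aN: "assoc_defect (mulN A) (mulN A) = 0"
    by (simp_all add: assoc_defect_def mul_assoc fun_eq_iff)
  have c3: "fst (fps_nth ?E n) = 0 \<longleftrightarrow> cur3 (fst (fps_nth ?E n)) = 0"
    "snd (fps_nth ?E n) = 0 \<longleftrightarrow> cur3 (snd (fps_nth ?E n)) = 0" for n
    by (rule cur3_eq_0_iff, erule zT) (rule cur3_eq_0_iff, erule zN)
  have "?E = 0 \<longleftrightarrow> (\<forall>n. fst (fps_nth ?E n) = 0 \<and> snd (fps_nth ?E n) = 0)"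
    unfolding fps_eq_iff prod_eq_iff by (simp only: fps_zero_nth fst_zero snd_zero)
  also have "\<dots> \<longleftrightarrow> (\<forall>n. cur3 (fst (fps_nth ?E n)) = 0) \<and> (\<forall>n. cur3 (snd (fps_nth ?E n)) = 0)"
    unfolding c3 by (rule all_conj_distrib)
  also have "\<dots> \<longleftrightarrow> fps_map (\<lambda>f. cur3 (fst f)) ?E = 0 \<and> fps_map (\<lambda>f. cur3 (snd f)) ?E = 0"
    unfolding fps_eq_iff by (simp only: fps_map_nth fps_zero_nth)
  also have "fps_map (\<lambda>f. cur3 (fst f)) ?E = fps_conv assoc_defect (fps_map curT ?F) (fps_map curT ?F)"
    by (rule maurer_cartan_map[OF modT rat additive_cur(1,3)])
      (simp_all add: gerst_bracketN_def arity_simps cur3_bracket_2_2 cochains2(1)[OF M] bihom_mul sT aT)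
  also have "fps_map (\<lambda>f. cur3 (snd f)) ?E = fps_conv assoc_defect (fps_map curN ?F) (fps_map curN ?F)"
    by (rule maurer_cartan_map[OF modN rat additive_cur(2,4)])
      (simp_all add: gerst_bracketN_def arity_simps cur3_bracket_2_2 cochains2(2)[OF M] bihom_mul sN aN)
  finally have "?E = 0 \<longleftrightarrow> assoc_series ?F"
    unfolding assoc_series_def fps_bil_assoc_iff[OF modT bF(1)] fps_bil_assoc_iff[OF modN bF(2)] .
  then show ?thesis
    using True by (simp only: maurer_cartan_def lambda_comp_1 mem_Collect_eq simp_thms)
qed (auto simp: maurer_cartan_def lambda_comp_1)

lemma shifted_series:
  assumes "fps_nth M 0 = 0" "cochain_series M"
  shows "cochain_series (fps_const (mu0 A) + M)" "fps_nth (fps_const (mu0 A) + M) 0 = mu0 A"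
  using assms mu0_cochain by (simp_all add: cochain_series_def)

section \<open>Maurer-Cartan elements correspond to deformations\<close>

lemma product_of_inj:
  assumes "cochain_series F" "cochain_series G" "product_of F = product_of G"
  shows "F = G"
proof (rule fps_ext)
  fix n
  have F: "fps_nth F n \<in> cochainsN A 2" "fps_nth G n \<in> cochainsN A 2"
    using assms by (auto simp: cochain_series_def)
  have eq: "fps_bil (fps_map curT F) = fps_bil (fps_map curT G)" "fps_bil (fps_map curN F) = fps_bil (fps_map curN G)"
    using assms(3) by (simp_all add: product_of_eq)
  have "fps_nth (fps_map curT F) n x y = fps_nth (fps_map curT G) n x y" for x y
    unfolding fps_bil_const[OF modT bihom_series(1)[OF assms(1)], symmetric]
      fps_bil_const[OF modT bihom_series(1)[OF assms(2)], symmetric] eq ..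
  moreover have "fps_nth (fps_map curN F) n x y = fps_nth (fps_map curN G) n x y" for x y
    unfolding fps_bil_const[OF modN bihom_series(2)[OF assms(1)], symmetric]
      fps_bil_const[OF modN bihom_series(2)[OF assms(2)], symmetric] eq ..
  ultimately show "fps_nth F n = fps_nth G n"
    using cochains2(5,6)[OF F(1)] cochains2(5,6)[OF F(2)] by (intro cochain_eqI ext) auto
qed

lemma bij_product:
  "bij_betw (\<lambda>M. product_of (fps_const (mu0 A) + M)) (maurer_cartan q (hochschildN A)) (deformations A)"
  unfolding bij_betw_def
proof
  show "inj_on (\<lambda>M. product_of (fps_const (mu0 A) + M)) (maurer_cartan q (hochschildN A))"
    using product_of_inj[OF shifted_series(1) shifted_series(1)]
    by (intro inj_onI) (unfold maurer_cartan_iff, metis add_left_cancel)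
  show "(\<lambda>M. product_of (fps_const (mu0 A) + M)) ` maurer_cartan q (hochschildN A) = deformations A"
  proof (intro equalityI image_subsetI subsetI)
    fix M assume "M \<in> maurer_cartan q (hochschildN A)"
    then have M: "fps_nth M 0 = 0" "cochain_series M" "assoc_series (fps_const (mu0 A) + M)"
      by (auto simp: maurer_cartan_iff)
    show "product_of (fps_const (mu0 A) + M) \<in> deformations A"
      unfolding deformations_def mem_Collect_eq
      using coisotropic_algebra_iff[OF shifted_series[OF M(1,2)]] M shifted_series[OF M(1,2)]
      by (intro conjI exI[of _ "fps_const (mu0 A) + M"]) (auto simp: cochain_series_def)
  next
    fix \<mu> assume "\<mu> \<in> deformations A"
    then obtain F where F: "coisotropic_algebra (series_algebra A \<mu>)" "fps_nth F 0 = mu0 A"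
      "\<forall>r\<ge>1. fps_nth F r \<in> cochainsN A 2" "\<mu> = product_of F"
      by (auto simp: deformations_def)
    define M where "M = F - fps_const (mu0 A)"
    have FM: "F = fps_const (mu0 A) + M" by (simp add: M_def)
    have "fps_nth M r \<in> cochainsN A 2" for r
      using F(2,3) zero_cochain by (cases r) (simp_all add: M_def)
    then have M: "fps_nth M 0 = 0" "cochain_series M"
      using F(2) by (simp_all add: M_def cochain_series_def)
    then have "M \<in> maurer_cartan q (hochschildN A)"
      using coisotropic_algebra_iff[OF shifted_series[OF M]] F by (simp add: maurer_cartan_iff FM)
    then show "\<mu> \<in> (\<lambda>M. product_of (fps_const (mu0 A) + M)) ` maurer_cartan q (hochschildN A)"
      using F(4) FM by blast
  qed
qed

end

section \<open>Gauge equivalence and equivalence of deformations\<close>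

abbreviation "linT \<equiv> \<lambda>f. cur1 (fst f)"
abbreviation "linN \<equiv> \<lambda>f. cur1 (snd f)"

text \<open>\<open>R\<close> is the pull-back of \<open>E\<close> along the bijection
  \<open>f\<close>, so it inherits all properties of an equivalence relation. Gauge equivalence is
  treated in this way.\<close>

lemma equiv_transport:
  assumes bij: "bij_betw f X Y" and "equiv Y E" and "R \<subseteq> X \<times> X"
    and R: "\<And>x y. x \<in> X \<Longrightarrow> y \<in> X \<Longrightarrow> (x, y) \<in> R \<longleftrightarrow> (f x, f y) \<in> E"
  shows "equiv X R" and "bij_betw ((`) f) (X // R) (Y // E)"
    and "\<And>x. x \<in> X \<Longrightarrow> f ` (R `` {x}) = E `` {f x}"
proof -
  have fX: "f x \<in> Y" if "x \<in> X" for x using bij that by (auto simp: bij_betw_def)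
  have E: "refl_on Y E" "sym E" "trans E" "E \<subseteq> Y \<times> Y"
    using assms(2) by (auto simp: equiv_def dest: equiv_type)
  show eq: "equiv X R"
  proof (rule equivI)
    show "R \<subseteq> X \<times> X" by fact
    show "refl_on X R"
      using assms(3) E(1) fX R by (auto simp: refl_on_def)
    show "sym R"
      using assms(3) E(2) fX R by (auto simp: sym_def)
    show "trans R"
    proof (rule transI)
      fix x y z assume "(x, y) \<in> R" "(y, z) \<in> R"
      then have X: "x \<in> X" "y \<in> X" "z \<in> X" and "(f x, f y) \<in> E" "(f y, f z) \<in> E"
        using assms(3) R by auto
      then show "(x, z) \<in> R" using E(3) R[OF X(1,3)] by (meson transE)
    qed
  qed
  show cl: "f ` (R `` {x}) = E `` {f x}" if "x \<in> X" for x
  proof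
    show "f ` (R `` {x}) \<subseteq> E `` {f x}" using assms(3) R by auto
    show "E `` {f x} \<subseteq> f ` (R `` {x})"
    proof
      fix y assume "y \<in> E `` {f x}"
      then have y: "(f x, y) \<in> E" by simp
      then have "y \<in> f ` X" using E(4) bij by (auto simp: bij_betw_def)
      then obtain x' where "x' \<in> X" "y = f x'" by auto
      then show "y \<in> f ` (R `` {x})" using y R[OF that] by auto
    qed
  qed
  show "bij_betw ((`) f) (X // R) (Y // E)"
    unfolding bij_betw_def
  proof
    have sub: "C \<subseteq> X" if "C \<in> X // R" for C using that assms(3) by (auto simp: quotient_def)
    show "inj_on ((`) f) (X // R)"
    proof (rule inj_onI)
      fix C D assume "C \<in> X // R" "D \<in> X // R" "f ` C = f ` D"
      then show "C = D"
        using inj_on_image_eq_iff[OF bij_betw_imp_inj_on[OF bij] sub sub] by simp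
    qed
    have "(`) f ` (X // R) = (\<lambda>x. f ` (R `` {x})) ` X"
      by (auto simp: quotient_def)
    also have "\<dots> = (\<lambda>x. E `` {f x}) ` X"
      by (rule image_cong) (simp_all add: cl)
    also have "\<dots> = (\<lambda>y. E `` {y}) ` (f ` X)"
      by (simp only: image_image)
    also have "f ` X = Y"
      by (rule bij_betw_imp_surj_on[OF bij])
    finally show "(`) f ` (X // R) = Y // E" by (auto simp: quotient_def)
  qed
qed

section \<open>Formal automorphisms as exponentials, and their action on products\<close>

context coiso_deformation
begin

text \<open>A power series in a pair of operators respects \<open>incl\<close> and
  \<open>sub0\<close> as soon as the pair does. The first conclusion is used for the logarithm, the
  second for the exponential.\<close>

lemma automorphism_op_series:
  assumes opT: "formal_op (scaleT A) q aT" and opN: "formal_op (scaleN A) q aN"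
    and incl: "\<And>x. fps_map (incl A) (aN x) = aT (fps_map (incl A) x)"
    and sub0: "\<And>x. \<forall>n. fps_nth x n \<in> sub0 A \<Longrightarrow> \<forall>n. fps_nth (aN x) n \<in> sub0 A"
  shows "coisotropic_morphism (series_module A) (series_module A)
      (op_series (scaleT A) q f aT, op_series (scaleN A) q f aN)"
    and "formal_automorphism A (op_series (scaleT A) q (fps_exp 1) aT, op_series (scaleN A) q (fps_exp 1) aN)"
proof -
  interpret T: formal_op "scaleT A" q aT by fact
  interpret N: formal_op "scaleN A" q aN by fact
  show mor: "coisotropic_morphism (series_module A) (series_module A)
      (op_series (scaleT A) q f aT, op_series (scaleN A) q f aN)" for f
    using N.ev_closed[OF subspace0 sub0]
    by (auto simp: coisotropic_morphism_def T.ev_hom N.ev_hom op_series_map[OF incl_hom, of aN aT, OF incl])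
  show "formal_automorphism A (op_series (scaleT A) q (fps_exp 1) aT, op_series (scaleN A) q (fps_exp 1) aN)"
    unfolding formal_automorphism_def
    using mor[of "fps_exp 1"] mor[of "fps_exp (- 1)"]
    by (auto intro!: exI[of _ "op_series (scaleT A) q (fps_exp (- 1)) aT"]
        exI[of _ "op_series (scaleN A) q (fps_exp (- 1)) aN"]
        simp: fun_eq_iff T.exp_inverse N.exp_inverse T.ev_nth_0 N.ev_nth_0 rat_embedding_simps[OF rat])
qed

lemma cochains1:
  assumes "f \<in> cochainsN A 1"
  shows "module_hom (scaleT A) (scaleT A) (linT f)" "module_hom (scaleN A) (scaleN A) (linN f)"
    "incl A (linN f x) = linT f (incl A x)"
    "x \<in> sub0 A \<Longrightarrow> linN f x \<in> sub0 A"
proof -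
  obtain fT fN where f: "f = (fT, fN)" by (cases f)
  have m: "multilinear (scaleT A) 1 fT" "multilinear (scaleN A) 1 fN"
    and i: "\<And>xs. length xs = 1 \<Longrightarrow> incl A (fN xs) = fT (map (incl A) xs)"
    and z: "\<And>xs. length xs = 1 \<and> (\<exists>x \<in> set xs. x \<in> sub0 A) \<Longrightarrow> fN xs \<in> sub0 A"
    using assms by (auto simp: cochainsN_def f)
  show "module_hom (scaleT A) (scaleT A) (linT f)" "module_hom (scaleN A) (scaleN A) (linN f)"
    using m by (simp_all add: f cur1_hom)
  show "incl A (linN f x) = linT f (incl A x)"
    using i[of "[x]"] by (simp add: f cur1_def)
  show "x \<in> sub0 A \<Longrightarrow> linN f x \<in> sub0 A"
    using z[of "[x]"] by (auto simp: f cur1_def)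
qed

abbreviation "expT \<gamma> \<equiv> op_series (scaleT A) q (fps_exp 1) (fps_app (fps_map linT \<gamma>))"
abbreviation "expN \<gamma> \<equiv> op_series (scaleN A) q (fps_exp 1) (fps_app (fps_map linN \<gamma>))"

lemma formal_derivations:
  assumes "\<gamma> \<in> lambda_comp (hochschildN A) 0"
  shows "formal_derivation (scaleT A) q (fps_map linT \<gamma>)" "formal_derivation (scaleN A) q (fps_map linN \<gamma>)"
proof -
  have \<gamma>: "fps_nth \<gamma> n \<in> cochainsN A 1" "fps_nth \<gamma> 0 = 0" for n using assms by (simp_all add: lambda_comp_0)
  show "formal_derivation (scaleT A) q (fps_map linT \<gamma>)" "formal_derivation (scaleN A) q (fps_map linN \<gamma>)"
    by (simp_all add: formal_derivation_def modT modN rat cochains1[OF \<gamma>(1)] \<gamma>(2))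
      (simp_all add: cur1_def fun_eq_iff)
qed

lemma formal_automorphism_exp:
  assumes "\<gamma> \<in> lambda_comp (hochschildN A) 0"
  shows "formal_automorphism A (expT \<gamma>, expN \<gamma>)"
proof (rule automorphism_op_series(2))
  have \<gamma>: "fps_nth \<gamma> n \<in> cochainsN A 1" for n using assms by (simp add: lambda_comp_0)
  show "formal_op (scaleT A) q (fps_app (fps_map linT \<gamma>))"
    by (rule formal_derivation.formal_op_app[OF formal_derivations(1)[OF assms]])
  show "formal_op (scaleN A) q (fps_app (fps_map linN \<gamma>))"
    by (rule formal_derivation.formal_op_app[OF formal_derivations(2)[OF assms]])
  show "fps_map (incl A) (fps_app (fps_map linN \<gamma>) x) = fps_app (fps_map linT \<gamma>) (fps_map (incl A) x)" for x
    by (rule fps_ext) (simp add: fps_app_def fps_conv_nth incl.sum cochains1[OF \<gamma>])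
  show "\<forall>n. fps_nth (fps_app (fps_map linN \<gamma>) x) n \<in> sub0 A" if "\<forall>n. fps_nth x n \<in> sub0 A" for x
    using that by (auto simp: fps_app_def fps_conv_nth intro!: mN.subspace_sum subspace0 cochains1(4)[OF \<gamma>])
qed

text \<open>\<open>log_series\<close> evaluated at \<open>T - id\<close> is a linear operator, hence
  a series of linear maps. Compatibility of \<open>T\<close> with \<open>incl\<close> and
  \<open>sub0\<close> passes to it and makes its coefficients 1-cochains.\<close>

lemma formal_automorphism_log:
  assumes "formal_automorphism A T"
  obtains \<gamma> where "\<gamma> \<in> lambda_comp (hochschildN A) 0" "fst T = expT \<gamma>" "snd T = expN \<gamma>"
proof -
  define aT where "aT = (\<lambda>x. fst T x - x)"
  define aN where "aN = (\<lambda>x. snd T x - x)"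
  have hom: "module_hom (fps_conv (scaleT A)) (fps_conv (scaleT A)) (fst T)"
    "module_hom (fps_conv (scaleN A)) (fps_conv (scaleN A)) (snd T)"
    and incl: "\<And>x. fst T (fps_map (incl A) x) = fps_map (incl A) (snd T x)"
    and sub: "\<And>x n. \<forall>n. fps_nth x n \<in> sub0 A \<Longrightarrow> fps_nth (snd T x) n \<in> sub0 A"
    using assms by (auto simp: formal_automorphism_def coisotropic_morphism_def)
  have opT: "formal_op (scaleT A) q aT" and opN: "formal_op (scaleN A) q aN"
    using assms by (auto simp: formal_op_def modT modN rat aT_def aN_def formal_automorphism_def hom
      intro!: module_hom_minus module_hom_ident module_series)
  interpret T: formal_op "scaleT A" q aT by fact
  interpret N: formal_op "scaleN A" q aN by fact
  have incl': "fps_map (incl A) (aN x) = aT (fps_map (incl A) x)" for x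
    by (rule fps_ext) (simp add: aT_def aN_def incl incl.diff)
  have sub': "\<forall>n. fps_nth (aN x) n \<in> sub0 A" if "\<forall>n. fps_nth x n \<in> sub0 A" for x
    using that sub[OF that] by (simp add: aN_def mN.subspace_diff subspace0)
  define lT where "lT = T.ev log_series"
  define lN where "lN = N.ev log_series"
  have "coisotropic_morphism (series_module A) (series_module A) (lT, lN)"
    unfolding lT_def lN_def by (rule automorphism_op_series(1)[OF opT opN incl' sub'])
  then have l: "module_hom (fps_conv (scaleT A)) (fps_conv (scaleT A)) lT"
    "module_hom (fps_conv (scaleN A)) (fps_conv (scaleN A)) lN"
    "\<And>x. fps_map (incl A) (lN x) = lT (fps_map (incl A) x)"
    "\<And>x n. \<forall>n. fps_nth x n \<in> sub0 A \<Longrightarrow> fps_nth (lN x) n \<in> sub0 A"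
    by (auto simp: coisotropic_morphism_def)
  define gT where "gT = (\<lambda>n a. fps_nth (lT (fps_const a)) n)"
  define gN where "gN = (\<lambda>n a. fps_nth (lN (fps_const a)) n)"
  \<comment> \<open>The value 0 off length 1 is what the encoding of cochains demands.\<close>
  define \<gamma> where "\<gamma> = Abs_fps (\<lambda>n. (\<lambda>xs. if length xs = 1 then gT n (hd xs) else 0,
      \<lambda>xs. if length xs = 1 then gN n (hd xs) else 0))"
  have "fps_map linT \<gamma> = Abs_fps gT" "fps_map linN \<gamma> = Abs_fps gN"
    by (auto intro!: fps_ext simp: \<gamma>_def cur1_def)
  then have act: "fps_app (fps_map linT \<gamma>) = lT" "fps_app (fps_map linN \<gamma>) = lN"
    using series_hom_eq_fps_app[OF modT modT l(1)] series_hom_eq_fps_app[OF modN modN l(2)]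
    by (simp_all add: gT_def gN_def)
  have g: "module_hom (scaleT A) (scaleT A) (gT n)" "module_hom (scaleN A) (scaleN A) (gN n)" for n
    unfolding gT_def gN_def by (rule nth_series_hom[OF modT modT l(1)]) (rule nth_series_hom[OF modN modN l(2)])
  have c: "fps_map (incl A) (fps_const a) = fps_const (incl A a)" for a
    by (rule fps_ext) simp
  have "incl A (gN n a) = gT n (incl A a)" for n a
    using arg_cong[OF l(3)[of "fps_const a"], of "\<lambda>x. fps_nth x n"] by (simp add: gT_def gN_def c)
  moreover have "gN n a \<in> sub0 A" if "a \<in> sub0 A" for n a
    unfolding gN_def using that mN.subspace_0[OF subspace0] by (intro l(4)) simp
  ultimately have "fps_nth \<gamma> n \<in> cochainsN A 1" for n
    using multilinear_1I[OF g(1), of n] multilinear_1I[OF g(2), of n]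
    by (auto simp: \<gamma>_def cochainsN_def length_Suc_conv)
  \<comment> \<open>Holds because log (1 + X) has no constant term.\<close>
  moreover have "fps_nth \<gamma> 0 = 0"
    by (auto simp: \<gamma>_def gT_def gN_def lT_def lN_def T.ev_nth_0 N.ev_nth_0 log_series_0
        rat_embedding_simps[OF rat] zero_prod_def fun_eq_iff)
  ultimately have "\<gamma> \<in> lambda_comp (hochschildN A) 0"
    by (simp add: lambda_comp_0)
  moreover have "fst T = expT \<gamma>" "snd T = expN \<gamma>"
    unfolding act lT_def lN_def by (simp_all add: fun_eq_iff T.exp_log N.exp_log)
      (simp_all add: aT_def aN_def)
  ultimately show thesis by (rule that)
qed

text \<open>Bilinearity of \<open>X\<close> is included because \<open>X\<close> is given only by
  the gauge formula, and comparing its coefficients through \<open>fps_bil_const\<close> requires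
  it.\<close>

lemma gauge_act_conjugation:
  assumes \<gamma>: "\<gamma> \<in> lambda_comp (hochschildN A) 0" and M: "fps_nth M 0 = 0" "cochain_series M"
  defines "F \<equiv> fps_const (mu0 A) + M" and "X \<equiv> fps_const (mu0 A) + gauge_act q (hochschildN A) \<gamma> M"
  shows "bihom (scaleT A) (fps_nth (fps_map curT X) i)" "bihom (scaleN A) (fps_nth (fps_map curN X) i)"
    and "fps_bil (fps_map curT X) (expT \<gamma> x) (expT \<gamma> y) = expT \<gamma> (fps_bil (fps_map curT F) x y)"
    and "fps_bil (fps_map curN X) (expN \<gamma> x') (expN \<gamma> y') = expN \<gamma> (fps_bil (fps_map curN F) x' y')"
proof -
  interpret T: formal_derivation "scaleT A" q "fps_map linT \<gamma>" by (rule formal_derivations[OF \<gamma>])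
  interpret N: formal_derivation "scaleN A" q "fps_map linN \<gamma>" by (rule formal_derivations[OF \<gamma>])
  have Mc: "fps_nth M i \<in> cochainsN A 2" for i using M by (simp add: cochain_series_def)
  have F: "cochain_series F" unfolding F_def by (rule shifted_series[OF M])
  have sT: "cur2 (\<lambda>xs. scaleT A c (h xs)) = (\<lambda>x y. scaleT A c (cur2 h x y))" for c h
    by (simp add: cur2_def)
  have sN: "cur2 (\<lambda>xs. scaleN A c (h xs)) = (\<lambda>x y. scaleN A c (cur2 h x y))" for c h
    by (simp add: cur2_def)
  have XT: "fps_map curT X = op_series (\<lambda>c f x y. scaleT A c (f x y)) q (fps_exp 1) T.ad (fps_map curT F)"
    unfolding X_def F_def
    by (rule gauge_act_map[OF T.formal_derivation_axioms additive_cur(1)])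
      (simp_all add: gerst_bracketN_def arity_simps cur2_bracket_1_2[simplified] cur2_bracket_2_1[simplified] cochains2(1)[OF Mc]
        bihom_mul sT)
  have XN: "fps_map curN X = op_series (\<lambda>c f x y. scaleN A c (f x y)) q (fps_exp 1) N.ad (fps_map curN F)"
    unfolding X_def F_def
    by (rule gauge_act_map[OF N.formal_derivation_axioms additive_cur(2)])
      (simp_all add: gerst_bracketN_def arity_simps cur2_bracket_1_2[simplified] cur2_bracket_2_1[simplified] cochains2(2)[OF Mc]
        bihom_mul sN)
  show "bihom (scaleT A) (fps_nth (fps_map curT X) i)" "bihom (scaleN A) (fps_nth (fps_map curN X) i)"
    unfolding XT XN by (rule T.exp_conjugation N.exp_conjugation, rule bihom_series[OF F])+
  show "fps_bil (fps_map curT X) (expT \<gamma> x) (expT \<gamma> y) = expT \<gamma> (fps_bil (fps_map curT F) x y)"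
    unfolding XT by (rule T.exp_conjugation(2)) (rule bihom_series[OF F])
  show "fps_bil (fps_map curN X) (expN \<gamma> x') (expN \<gamma> y') = expN \<gamma> (fps_bil (fps_map curN F) x' y')"
    unfolding XN by (rule N.exp_conjugation(2)) (rule bihom_series[OF F])
qed

text \<open>Every term of the gauge formula is \<open>M\<close> itself or a bracket of arities 1 and
  2 or 2 and 1, and all of these vanish off length 2.\<close>

lemma gauge_act_length:
  assumes "cochain_series M" "length xs \<noteq> 2" "length ys \<noteq> 2"
  shows "fst (fps_nth (gauge_act q (hochschildN A) \<gamma> M) n) xs = 0"
    and "snd (fps_nth (gauge_act q (hochschildN A) \<gamma> M) n) ys = 0"
proof -
  let ?ad = "fps_conv (brak (hochschildN A) 0 1) \<gamma>"
  let ?Z = "\<lambda>x. \<forall>n. fst (fps_nth x n) xs = 0 \<and> snd (fps_nth x n) ys = 0"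
  have ad: "?Z (?ad x)" for x
    using assms(2,3) by (simp add: fps_conv_nth fst_sum snd_sum sum_fun_apply arity_simps gerst_bracketN_def
      gerst_bracket_1_2_length[simplified])
  have pow: "?Z ((?ad ^^ j) x)" if "?Z x" for j x
    using that ad by (cases j) auto
  have M: "?Z M" using assms cochains2(5,6) by (auto simp: cochain_series_def)
  have d: "?Z (fps_map (diff (hochschildN A) 0) \<gamma>)"
    using assms(2,3) by (simp add: arity_simps gerst_bracketN_def gerst_bracket_2_1_length[simplified])
  show "fst (fps_nth (gauge_act q (hochschildN A) \<gamma> M) n) xs = 0"
    "snd (fps_nth (gauge_act q (hochschildN A) \<gamma> M) n) ys = 0"
    using pow[OF M] pow[OF d]
    by (simp_all add: gauge_act_def Let_def fst_sum snd_sum sum_fun_apply del: hochschildN_simps(3,4))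
qed

text \<open>From left to right \<open>T\<close> is the exponential of the gauge parameter; from
  right to left the gauge parameter is the logarithm of \<open>T\<close>.\<close>

lemma gauge_rel_iff:
  assumes "M \<in> maurer_cartan q (hochschildN A)" "M' \<in> maurer_cartan q (hochschildN A)"
  shows "(M, M') \<in> gauge_rel q (hochschildN A) \<longleftrightarrow>
    (product_of (fps_const (mu0 A) + M), product_of (fps_const (mu0 A) + M')) \<in> deformation_equiv A"
proof -
  let ?F = "fps_const (mu0 A) + M" and ?F' = "fps_const (mu0 A) + M'"
  have M: "fps_nth M 0 = 0" "cochain_series M" and M': "fps_nth M' 0 = 0" "cochain_series M'"
    using assms by (auto simp: maurer_cartan_iff)
  have def: "product_of ?F \<in> deformations A" "product_of ?F' \<in> deformations A"
    using bij_product assms by (auto simp: bij_betw_def)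
  have F': "cochain_series ?F'" by (rule shifted_series[OF M'])
  show ?thesis
  proof
    assume "(M, M') \<in> gauge_rel q (hochschildN A)"
    then obtain \<gamma> where \<gamma>: "\<gamma> \<in> lambda_comp (hochschildN A) 0" "M' = gauge_act q (hochschildN A) \<gamma> M"
      by (auto simp: gauge_rel_def)
    show "(product_of ?F, product_of ?F') \<in> deformation_equiv A"
      using def formal_automorphism_exp[OF \<gamma>(1)] gauge_act_conjugation(3,4)[OF \<gamma>(1) M]
      unfolding deformation_equiv_def \<gamma>(2)
      by (auto simp: product_of_eq intro!: exI[of _ "expT \<gamma>"] exI[of _ "expN \<gamma>"])
  next
    assume "(product_of ?F, product_of ?F') \<in> deformation_equiv A"
    then obtain T where T: "formal_automorphism A T"
      "\<And>x y. fst T (fst (product_of ?F) x y) = fst (product_of ?F') (fst T x) (fst T y)"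
      "\<And>x y. snd T (snd (product_of ?F) x y) = snd (product_of ?F') (snd T x) (snd T y)"
      by (auto simp: deformation_equiv_def)
    have surj: "surj (fst T)" "surj (snd T)"
      using T(1) unfolding formal_automorphism_def by (metis comp_apply id_apply surj_def)+
    obtain \<gamma> where \<gamma>: "\<gamma> \<in> lambda_comp (hochschildN A) 0" "fst T = expT \<gamma>" "snd T = expN \<gamma>"
      by (rule formal_automorphism_log[OF T(1)])
    define X where "X = fps_const (mu0 A) + gauge_act q (hochschildN A) \<gamma> M"
    note X = gauge_act_conjugation[OF \<gamma>(1) M, folded X_def \<gamma>(2,3)]
    \<comment> \<open>\<open>T\<close> carries the product of \<open>?F\<close> both to that of
      \<open>X\<close> and to that of \<open>?F'\<close>. Every argument is a value of
      \<open>T\<close>, so the two products coincide.\<close>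
    have "fps_bil (fps_map curT X) x y = fps_bil (fps_map curT ?F') x y" for x y
    proof -
      obtain u v where "x = fst T u" "y = fst T v" using surj(1) by (meson surj_def)
      then show ?thesis using X(3)[of u v] T(2)[of u v] by (simp add: product_of_eq)
    qed
    then have "fps_nth (fps_map curT X) n x y = fps_nth (fps_map curT ?F') n x y" for n x y
      unfolding fps_bil_const[OF modT X(1), symmetric] fps_bil_const[OF modT bihom_series(1)[OF F'], symmetric]
      by simp
    then have eqT: "curT (fps_nth X n) = curT (fps_nth ?F' n)" for n
      by (intro ext) simp
    have "fps_bil (fps_map curN X) x y = fps_bil (fps_map curN ?F') x y" for x y
    proof -
      obtain u v where "x = snd T u" "y = snd T v" using surj(2) by (meson surj_def)
      then show ?thesis using X(4)[of u v] T(3)[of u v] by (simp add: product_of_eq)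
    qed
    then have "fps_nth (fps_map curN X) n x y = fps_nth (fps_map curN ?F') n x y" for n x y
      unfolding fps_bil_const[OF modN X(2), symmetric] fps_bil_const[OF modN bihom_series(2)[OF F'], symmetric]
      by simp
    then have eqN: "curN (fps_nth X n) = curN (fps_nth ?F' n)" for n
      by (intro ext) simp
    have "fps_nth X n = fps_nth ?F' n" for n
    proof (rule cochain_eqI[OF eqT eqN])
      have "fps_nth M' n \<in> cochainsN A 2" using M' by (simp add: cochain_series_def)
      note z = cochains2(5,6)[OF this]
      show "fst (fps_nth X n) xs = fst (fps_nth ?F' n) xs" if "length xs \<noteq> 2" for xs
        \<comment> \<open>The empty list fills the slot of the other component with an argument of
          length other than 2.\<close>
        using gauge_act_length(1)[OF M(2) that, of "[]"] z(1)[OF that] by (simp add: X_def)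
      show "snd (fps_nth X n) xs = snd (fps_nth ?F' n) xs" if "length xs \<noteq> 2" for xs
        using gauge_act_length(2)[OF M(2) _ that, of "[]"] z(2)[OF that] by (simp add: X_def)
    qed
    then have "X = ?F'" by (rule fps_ext)
    then have "M' = gauge_act q (hochschildN A) \<gamma> M" by (simp add: X_def)
    then show "(M, M') \<in> gauge_rel q (hochschildN A)"
      using assms \<gamma>(1) by (auto simp: gauge_rel_def)
  qed
qed

section \<open>Equivalence of deformations is an equivalence relation\<close>

lemma formal_automorphism_id: "formal_automorphism A (id, id)"
  using coisotropic_morphism_id[OF coisotropic_series_module[OF module_A]]
  by (auto simp: formal_automorphism_def intro!: exI[of _ id])

lemma formal_automorphism_comp:
  assumes "formal_automorphism A S" "formal_automorphism A T"
  shows "formal_automorphism A (fst T \<circ> fst S, snd T \<circ> snd S)"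
proof -
  obtain S' T' where
    S': "coisotropic_morphism (series_module A) (series_module A) S'"
      "fst S' \<circ> fst S = id" "fst S \<circ> fst S' = id" "snd S' \<circ> snd S = id" "snd S \<circ> snd S' = id" and
    T': "coisotropic_morphism (series_module A) (series_module A) T'"
      "fst T' \<circ> fst T = id" "fst T \<circ> fst T' = id" "snd T' \<circ> snd T = id" "snd T \<circ> snd T' = id"
    using assms unfolding formal_automorphism_def by metis
  have "coisotropic_morphism (series_module A) (series_module A) (fst T \<circ> fst S, snd T \<circ> snd S)"
    "coisotropic_morphism (series_module A) (series_module A) (fst S' \<circ> fst T', snd S' \<circ> snd T')"
    using assms S'(1) T'(1) by (auto simp: formal_automorphism_def intro: coisotropic_morphism_comp)
  moreover have "fst S' \<circ> fst T' \<circ> (fst T \<circ> fst S) = id" "fst T \<circ> fst S \<circ> (fst S' \<circ> fst T') = id"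
    "snd S' \<circ> snd T' \<circ> (snd T \<circ> snd S) = id" "snd T \<circ> snd S \<circ> (snd S' \<circ> snd T') = id"
    using S' T' by (simp_all add: fun_eq_iff)
  ultimately show ?thesis
    using assms unfolding formal_automorphism_def
    by (intro conjI exI[of _ "(fst S' \<circ> fst T', snd S' \<circ> snd T')"]) simp_all
qed

lemma formal_automorphism_inverse:
  assumes "formal_automorphism A T"
  obtains S where "formal_automorphism A S" "fst S \<circ> fst T = id" "fst T \<circ> fst S = id"
    "snd S \<circ> snd T = id" "snd T \<circ> snd S = id"
proof -
  obtain S where S: "coisotropic_morphism (series_module A) (series_module A) S"
      "fst S \<circ> fst T = id" "fst T \<circ> fst S = id" "snd S \<circ> snd T = id" "snd T \<circ> snd S = id"
    using assms unfolding formal_automorphism_def by metis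
  have inv: "\<And>x. fst T (fst S x) = x" "\<And>x. snd T (snd S x) = x"
    using S by (simp_all add: fun_eq_iff)
  \<comment> \<open>\<open>T\<close> preserves constant coefficients, so \<open>S x\<close> has the
    same one as \<open>T (S x) = x\<close>.\<close>
  have "fps_nth (fst S x) 0 = fps_nth x 0" "fps_nth (snd S x') 0 = fps_nth x' 0" for x x'
    using assms inv unfolding formal_automorphism_def by metis+
  then have "formal_automorphism A S"
    using assms S unfolding formal_automorphism_def by (intro conjI exI[of _ T]) auto
  then show thesis using S(2-5) by (rule that)
qed

lemma equiv_deformation_equiv: "equiv (deformations A) (deformation_equiv A)"
proof (rule equivI)
  show "deformation_equiv A \<subseteq> deformations A \<times> deformations A"
    by (auto simp: deformation_equiv_def)
  show "refl_on (deformations A) (deformation_equiv A)"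
    using formal_automorphism_id by (fastforce simp: refl_on_def deformation_equiv_def)
  show "sym (deformation_equiv A)"
  proof (rule symI)
    fix \<mu> \<nu> assume "(\<mu>, \<nu>) \<in> deformation_equiv A"
    then obtain T where d: "\<mu> \<in> deformations A" "\<nu> \<in> deformations A" and T: "formal_automorphism A T"
      "\<And>x y. fst T (fst \<mu> x y) = fst \<nu> (fst T x) (fst T y)"
      "\<And>x y. snd T (snd \<mu> x y) = snd \<nu> (snd T x) (snd T y)"
      by (auto simp: deformation_equiv_def)
    obtain S where S: "formal_automorphism A S" "fst S \<circ> fst T = id" "fst T \<circ> fst S = id"
      "snd S \<circ> snd T = id" "snd T \<circ> snd S = id"
      by (rule formal_automorphism_inverse[OF T(1)])
    have inv: "\<And>x. fst S (fst T x) = x" "\<And>x. fst T (fst S x) = x"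
      "\<And>x. snd S (snd T x) = x" "\<And>x. snd T (snd S x) = x"
      using S(2-5) by (simp_all add: fun_eq_iff)
    have "fst S (fst \<nu> x y) = fst \<mu> (fst S x) (fst S y)" for x y
      using T(2)[of "fst S x" "fst S y"] inv by metis
    moreover have "snd S (snd \<nu> x y) = snd \<mu> (snd S x) (snd S y)" for x y
      using T(3)[of "snd S x" "snd S y"] inv by metis
    ultimately show "(\<nu>, \<mu>) \<in> deformation_equiv A"
      using d S(1) unfolding deformation_equiv_def by blast
  qed
  show "trans (deformation_equiv A)"
  proof (rule transI)
    fix \<mu> \<nu> \<pi> assume "(\<mu>, \<nu>) \<in> deformation_equiv A" "(\<nu>, \<pi>) \<in> deformation_equiv A"
    then obtain S T where d: "\<mu> \<in> deformations A" "\<pi> \<in> deformations A"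
      and S: "formal_automorphism A S"
      "\<And>x y. fst S (fst \<mu> x y) = fst \<nu> (fst S x) (fst S y)"
      "\<And>x y. snd S (snd \<mu> x y) = snd \<nu> (snd S x) (snd S y)"
      and T: "formal_automorphism A T"
      "\<And>x y. fst T (fst \<nu> x y) = fst \<pi> (fst T x) (fst T y)"
      "\<And>x y. snd T (snd \<nu> x y) = snd \<pi> (snd T x) (snd T y)"
      unfolding deformation_equiv_def by blast
    show "(\<mu>, \<pi>) \<in> deformation_equiv A"
      unfolding deformation_equiv_def using d formal_automorphism_comp[OF S(1) T(1)] S T
      by (auto intro!: exI[of _ "fst T \<circ> fst S"] exI[of _ "snd T \<circ> snd S"])
  qed
qed

end

theorem theorem4p19:
  fixes q :: "rat \<Rightarrow> 'k::comm_ring_1"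
    and A :: "('k, 'a::ab_group_add, 'n::ab_group_add) coiso_algebra"
  assumes "rat_embedding q"
    and "coisotropic_algebra A"
  shows "equiv (maurer_cartan q (dglaN (hochschild A))) (gauge_rel q (dglaN (hochschild A))) \<and>
    equiv (deformations A) (deformation_equiv A) \<and>
    (\<exists>\<Phi>. bij_betw \<Phi> (Def_N q (hochschild A)) (deformations A // deformation_equiv A) \<and>
      (\<forall>M \<in> maurer_cartan q (dglaN (hochschild A)).
        product_of (fps_const (mu0 A) + M) \<in> deformations A \<and>
        \<Phi> (gauge_rel q (dglaN (hochschild A)) `` {M}) =
          deformation_equiv A `` {product_of (fps_const (mu0 A) + M)}))"
proof -
  interpret coiso_deformation q A by unfold_locales fact+
  have N: "dglaN (hochschild A) = hochschildN A" by (simp add: hochschild_def)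
  have sub: "gauge_rel q (hochschildN A) \<subseteq> maurer_cartan q (hochschildN A) \<times> maurer_cartan q (hochschildN A)"
    by (auto simp: gauge_rel_def)
  \<comment> \<open>The witness for \<Phi> is the image of a class under
    \<open>M \<mapsto> product_of (fps_const (mu0 A) + M)\<close>.\<close>
  note transport = equiv_transport[OF bij_product equiv_deformation_equiv sub gauge_rel_iff]
  have "product_of (fps_const (mu0 A) + M) \<in> deformations A" if "M \<in> maurer_cartan q (hochschildN A)" for M
    using bij_betwE[OF bij_product] that by blast
  then show ?thesis
    unfolding N Def_N_def using transport equiv_deformation_equiv by blast
qed

end
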